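(* Let $p$ be a prime, $n\ge1$, and let $k<l$ be positive integers. Then in the ring $\tilde R$ described in the context, $\tilde T(p^k)\tilde T(p^l)\ne\tilde T(p^l)\tilde T(p^k)$.
   Context: Let $J=\begin{pmatrix}0&E_n\\-E_n&0\end{pmatrix}$, $G=GSp_{2n}(\mathbb Q_p)=\{g: {}^tgJg=\mu(g)J\}$, $\Delta=G\cap M_{2n}(\mathbb Z_p)$, $\Gamma=G\cap GL_{2n}(\mathbb Z_p)$, $\mathcal M=\mathbb Z_p^{2n}$ (columns). $\tilde\Delta=\Delta\times\mathcal M$ is the monoid with $(A,\mathbf a)(B,\mathbf b)=(AB,A\mathbf b+\mu(B)\mathbf a)$ and $\tilde\Gamma=\Gamma\times\mathcal M$. $\tilde R$ is the Hecke ring of $(\tilde\Gamma,\tilde\Delta)$: the free abelian group on $\tilde\Gamma\backslash\tilde\Delta/\tilde\Gamma$ with product $(\tilde\Gamma\alpha\tilde\Gamma)(\tilde\Gamma\beta\tilde\Gamma)=\sum m_\gamma\,\tilde\Gamma\gamma\tilde\Gamma$, $m_\gamma=\#\{\tilde\Gamma\delta\in\tilde\Gamma\backslash\tilde\Gamma\beta\tilde\Gamma:\gamma\delta^{-1}\in\tilde\Gamma\alpha\tilde\Gamma\}$. $\tilde T(p^k)$ is the sum of all double cosets $\tilde\Gamma(C,\mathbf c)\tilde\Gamma$ with $v_p(\mu(C))=k$. *)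

theory Defs
  imports
    "HOL-Algebra.Free_Abelian_Groups"
    "HOL-Computational_Algebra.Polynomial_Factorial"
    "Jordan_Normal_Form.Matrix"
    "Berlekamp_Zassenhaus.Finite_Field"
begin

text \<open>
  The prime is carried by a type: \<open>'p :: prime_card\<close> ranges over all types with a prime
  number \<open>CARD('p)\<close> of elements, and \<open>p = CARD('p)\<close>.

  A \<open>p\<close>-adic integer is an element of the inverse limit of the rings \<open>\<int>/p\<^sup>i\<int>\<close>, i.e. a coherent
  sequence of residues.  The single condition below also forces \<open>0 \<le> x i < p\<^sup>i\<close>.
\<close>

typedef (overloaded) 'p padic_int =
    "{x :: nat \<Rightarrow> int. \<forall>i. x (Suc i) mod int CARD('p :: prime_card) ^ i = x i}"
  morphisms residue Abs_padic_int
  by (rule exI[of _ "\<lambda>_. 0"]) simp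

setup_lifting type_definition_padic_int

lemma p_gt_1: "int CARD('p :: prime_card) > 1"
  using prime_card_int[where 'a = 'p] by (rule prime_gt_1_int)

lemma residue_Suc: "residue (x :: 'p :: prime_card padic_int) (Suc i) mod int CARD('p) ^ i = residue x i"
  using residue[of x] by simp

lemma residue_mod: "i \<le> j \<Longrightarrow> residue (x :: 'p :: prime_card padic_int) j mod int CARD('p) ^ i = residue x i"
proof (induction j rule: dec_induct)
  case base
  show ?case using residue_Suc[of x i] by (metis mod_mod_trivial)
next
  case (step j)
  have "residue x (Suc j) mod int CARD('p) ^ i
      = residue x (Suc j) mod int CARD('p) ^ j mod int CARD('p) ^ i"
    using step.hyps by (simp add: mod_mod_cancel le_imp_power_dvd)
  then show ?case using step.IH by (simp add: residue_Suc)
qed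

lemma residue_mod_same [simp]:
  "residue (x :: 'p :: prime_card padic_int) i mod int CARD('p) ^ i = residue x i"
  by (rule residue_mod) simp

instantiation padic_int :: (prime_card) comm_ring_1
begin

lift_definition zero_padic_int :: "'a padic_int" is "\<lambda>i. 0" by simp

lift_definition one_padic_int :: "'a padic_int" is "\<lambda>i. 1 mod int CARD('a) ^ i"
  by (simp add: mod_mod_cancel)

lift_definition plus_padic_int :: "'a padic_int \<Rightarrow> 'a padic_int \<Rightarrow> 'a padic_int"
  is "\<lambda>x y i. (x i + y i) mod int CARD('a) ^ i"
  by (simp add: mod_mod_cancel) (metis mod_add_eq)

lift_definition uminus_padic_int :: "'a padic_int \<Rightarrow> 'a padic_int"
  is "\<lambda>x i. (- x i) mod int CARD('a) ^ i"
  by (simp add: mod_mod_cancel) (metis mod_minus_eq)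

lift_definition minus_padic_int :: "'a padic_int \<Rightarrow> 'a padic_int \<Rightarrow> 'a padic_int"
  is "\<lambda>x y i. (x i - y i) mod int CARD('a) ^ i"
  by (simp add: mod_mod_cancel) (metis mod_diff_eq)

lift_definition times_padic_int :: "'a padic_int \<Rightarrow> 'a padic_int \<Rightarrow> 'a padic_int"
  is "\<lambda>x y i. (x i * y i) mod int CARD('a) ^ i"
  by (simp add: mod_mod_cancel) (metis mod_mult_eq)

instance
proof
  fix a b c :: "'a padic_int"
  have range: "x i mod int CARD('a) ^ i = x i"
    if "\<forall>i. x (Suc i) mod int CARD('a) ^ i = x i" for x :: "nat \<Rightarrow> int" and i
    using that by (metis mod_mod_trivial)
  show "a + b + c = a + (b + c)" by transfer (auto simp: fun_eq_iff mod_simps algebra_simps)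
  show "a + b = b + a" by transfer (auto simp: fun_eq_iff algebra_simps)
  show "0 + a = a" by transfer (auto simp: fun_eq_iff range)
  show "- a + a = 0" by transfer (auto simp: fun_eq_iff mod_simps)
  show "a - b = a + - b" by transfer (auto simp: fun_eq_iff mod_simps)
  show "a * b * c = a * (b * c)" by transfer (auto simp: fun_eq_iff mod_simps algebra_simps)
  show "a * b = b * a" by transfer (auto simp: fun_eq_iff algebra_simps)
  show "1 * a = a" by transfer (auto simp: fun_eq_iff mod_simps range)
  show "(a + b) * c = a * c + b * c" by transfer (auto simp: fun_eq_iff mod_simps algebra_simps)
  have "(1 :: int) mod int CARD('a) ^ Suc 0 \<noteq> 0" using p_gt_1[where 'p = 'a] by simp
  then show "(0 :: 'a padic_int) \<noteq> 1" by transfer (metis)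
qed

end

lemma residue_mult:
  "residue (x * y :: 'p :: prime_card padic_int) i = residue x i * residue y i mod int CARD('p) ^ i"
  by transfer simp

lemma padic_int_eq_0_iff: "x = 0 \<longleftrightarrow> (\<forall>i. residue (x :: 'p :: prime_card padic_int) i = 0)"
  by transfer auto

instance padic_int :: (prime_card) idom
proof
  fix x y :: "'a padic_int"
  let ?p = "int CARD('a)"
  assume "x \<noteq> 0" "y \<noteq> 0"
  then obtain i j where i: "residue x i \<noteq> 0" and j: "residue y j \<noteq> 0"
    by (auto simp: padic_int_eq_0_iff)
  let ?u = "residue x (i + j)" and ?v = "residue y (i + j)"
  have u: "\<not> ?p ^ i dvd ?u" using i residue_mod[of i "i + j" x] by (simp add: dvd_eq_mod_eq_0)
  have v: "\<not> ?p ^ j dvd ?v" using j residue_mod[of j "i + j" y] by (simp add: dvd_eq_mod_eq_0)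
  have prime: "prime ?p" by (rule prime_card_int)
  have nz: "?u \<noteq> 0" "?v \<noteq> 0" using u v by auto
  have "multiplicity ?p ?u < i" "multiplicity ?p ?v < j"
    using u v nz p_gt_1[where 'p = 'a] by (auto simp: power_dvd_iff_le_multiplicity not_le)
  then have "multiplicity ?p (?u * ?v) < i + j"
    using nz prime by (simp add: prime_elem_multiplicity_mult_distrib)
  then have "\<not> ?p ^ (i + j) dvd ?u * ?v"
    using nz p_gt_1[where 'p = 'a] by (subst power_dvd_iff_le_multiplicity) auto
  then show "x * y \<noteq> 0"
    by (auto simp: padic_int_eq_0_iff residue_mult dvd_eq_mod_eq_0 intro!: exI[of _ "i + j"])
qed

type_synonym 'p padic = "'p padic_int fract"

text \<open>The copy of \<open>\<int>\<^sub>p\<close> inside \<open>\<rat>\<^sub>p\<close>.\<close>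

definition padic_integers :: "'p :: prime_card padic set" where
  "padic_integers = range to_fract"

text \<open>The exponent \<open>v\<close> in \<open>x = p\<^sup>v u\<close>, \<open>u\<close> a unit of \<open>\<int>\<^sub>p\<close>; only meaningful for \<open>x \<noteq> 0\<close>.\<close>

definition padic_val :: "'p :: prime_card padic \<Rightarrow> int" where
  "padic_val x =
    (THE v. \<exists>u :: 'p padic_int. u dvd 1 \<and> x = of_nat CARD('p) powi v * to_fract u)"

definition symp_J :: "nat \<Rightarrow> 'a :: comm_ring_1 mat" where
  "symp_J n = four_block_mat (0\<^sub>m n n) (1\<^sub>m n) (- 1\<^sub>m n) (0\<^sub>m n n)"

definition GSp :: "nat \<Rightarrow> 'a :: comm_ring_1 mat set" where
  "GSp n = {g \<in> carrier_mat (2 * n) (2 * n). invertible_mat g \<and>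
             (\<exists>m. transpose_mat g * symp_J n * g = m \<cdot>\<^sub>m symp_J n)}"

definition similitude :: "nat \<Rightarrow> 'a :: comm_ring_1 mat \<Rightarrow> 'a" where
  "similitude n g = (THE m. transpose_mat g * symp_J n * g = m \<cdot>\<^sub>m symp_J n)"

definition integral_mats :: "nat \<Rightarrow> 'p :: prime_card padic mat set" where
  "integral_mats m = {A \<in> carrier_mat m m. elements_mat A \<subseteq> padic_integers}"

definition integral_GL :: "nat \<Rightarrow> 'p :: prime_card padic mat set" where
  "integral_GL m =
    {A \<in> integral_mats m. \<exists>B \<in> integral_mats m. A * B = 1\<^sub>m m \<and> B * A = 1\<^sub>m m}"

definition Delta :: "nat \<Rightarrow> 'p :: prime_card padic mat set" where
  "Delta n = GSp n \<inter> integral_mats (2 * n)"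

definition Gamma :: "nat \<Rightarrow> 'p :: prime_card padic mat set" where
  "Gamma n = GSp n \<inter> integral_GL (2 * n)"

definition integral_vecs :: "nat \<Rightarrow> 'p :: prime_card padic vec set" where
  "integral_vecs n = {v \<in> carrier_vec (2 * n). set\<^sub>v v \<subseteq> padic_integers}"

text \<open>
  The ambient group \<open>GSp\<^sub>2\<^sub>n(\<rat>\<^sub>p) \<times> \<rat>\<^sub>p\<^sup>2\<^sup>n\<close>, in which the inverses of the
  elements of \<open>Delta_tilde n\<close> are taken; its multiplication restricts to that of the monoid.
\<close>

definition G_tilde :: "nat \<Rightarrow> ('p :: prime_card padic mat \<times> 'p padic vec) monoid" where
  "G_tilde n = \<lparr>carrier = GSp n \<times> carrier_vec (2 * n),
     monoid.mult = (\<lambda>(A, a) (B, b). (A * B, A *\<^sub>v b + similitude n B \<cdot>\<^sub>v a)),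
     one = (1\<^sub>m (2 * n), 0\<^sub>v (2 * n))\<rparr>"

definition Delta_tilde :: "nat \<Rightarrow> ('p :: prime_card padic mat \<times> 'p padic vec) set" where
  "Delta_tilde n = Delta n \<times> integral_vecs n"

definition Gamma_tilde :: "nat \<Rightarrow> ('p :: prime_card padic mat \<times> 'p padic vec) set" where
  "Gamma_tilde n = Gamma n \<times> integral_vecs n"

definition double_coset :: "('a, 'b) monoid_scheme \<Rightarrow> 'a set \<Rightarrow> 'a \<Rightarrow> 'a set" where
  "double_coset G H \<alpha> = H <#>\<^bsub>G\<^esub> {\<alpha>} <#>\<^bsub>G\<^esub> H"

definition double_cosets :: "('a, 'b) monoid_scheme \<Rightarrow> 'a set \<Rightarrow> 'a set \<Rightarrow> 'a set set" where
  "double_cosets G H D = double_coset G H ` D"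

text \<open>
  The structure constant \<open>m\<^sub>\<gamma>\<close> of the double cosets \<open>X = H\<alpha>H\<close> and \<open>Y = H\<beta>H\<close>.  The one-sided
  cosets counted are the \<open>H\<delta>\<close>, which HOL-Algebra calls right cosets.
\<close>

definition hecke_coeff ::
    "('a, 'b) monoid_scheme \<Rightarrow> 'a set \<Rightarrow> 'a set \<Rightarrow> 'a set \<Rightarrow> 'a \<Rightarrow> nat" where
  "hecke_coeff G H X Y \<gamma> =
    card {H #>\<^bsub>G\<^esub> \<delta> | \<delta>. \<delta> \<in> Y \<and> \<gamma> \<otimes>\<^bsub>G\<^esub> inv\<^bsub>G\<^esub> \<delta> \<in> X}"


text \<open>
  The product of two basis elements.  The coefficient \<open>m\<^sub>\<gamma>\<close> depends only on the double coset of
  \<open>\<gamma>\<close>, so it is read off at an arbitrary representative, and the sum runs over the double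
  cosets in which it does not vanish (finitely many for a Hecke pair).
\<close>

definition hecke_basis_mult ::
    "('a, 'b) monoid_scheme \<Rightarrow> 'a set \<Rightarrow> 'a set \<Rightarrow> 'a set \<Rightarrow> 'a set \<Rightarrow> ('a set \<Rightarrow>\<^sub>0 int)" where
  "hecke_basis_mult G H D X Y =
    (\<Sum>Z | Z \<in> double_cosets G H D \<and> hecke_coeff G H X Y (SOME \<gamma>. \<gamma> \<in> Z) \<noteq> 0.
       frag_cmul (int (hecke_coeff G H X Y (SOME \<gamma>. \<gamma> \<in> Z))) (frag_of Z))"

definition hecke_ring ::
    "('a, 'b) monoid_scheme \<Rightarrow> 'a set \<Rightarrow> 'a set \<Rightarrow> ('a set \<Rightarrow>\<^sub>0 int) ring" where
  "hecke_ring G H D =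
    \<lparr>carrier = carrier (free_Abelian_group (double_cosets G H D)),
     monoid.mult = (\<lambda>f g. frag_extend (\<lambda>X. frag_extend (hecke_basis_mult G H D X) g) f),
     one = frag_of (double_coset G H \<one>\<^bsub>G\<^esub>),
     zero = 0,
     add = (+)\<rparr>"

definition R_tilde ::
    "'p :: prime_card itself \<Rightarrow> nat \<Rightarrow> (('p padic mat \<times> 'p padic vec) set \<Rightarrow>\<^sub>0 int) ring" where
  "R_tilde _ n = hecke_ring (G_tilde n) (Gamma_tilde n) (Delta_tilde n)"

text \<open>\<open>T_tilde TYPE('p) n k\<close> is the element of index \<open>p\<^sup>k\<close>.  Only finitely many double cosets have
  similitude of valuation \<open>k\<close>, so the sum is a genuine one.\<close>

definition T_tilde ::
    "'p :: prime_card itself \<Rightarrow> nat \<Rightarrow> nat \<Rightarrow> (('p padic mat \<times> 'p padic vec) set \<Rightarrow>\<^sub>0 int)" where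
  "T_tilde _ n k =
    (\<Sum>X \<in> {double_coset (G_tilde n) (Gamma_tilde n) (C, c) | C c.
              (C, c) \<in> Delta_tilde n \<and> padic_val (similitude n C) = int k}. frag_of X)"

end

theory Submission
  imports Defs "HOL-Number_Theory.Modular_Inverse"
begin

text \<open>
  A double coset occurs in a product of two sums of double cosets iff it lies in the product of the
  corresponding subsets of \<open>G_tilde n\<close>. So it is enough to find an element of
  \<open>\<Delta>\<^sub>k \<Delta>\<^sub>l\<close> outside \<open>\<Delta>\<^sub>l
  \<Delta>\<^sub>k\<close>, where \<open>\<Delta>\<^sub>m\<close>, called \<open>level n m\<close>
  below, is the set of elements of \<open>Delta_tilde n\<close> with similitude of valuation
  \<open>m\<close>. The element is written down explicitly, and it is separated from
  \<open>\<Delta>\<^sub>l \<Delta>\<^sub>k\<close> by the valuation of a value of the symplectic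
  form. All sums and coefficients involved are finite, since the coset \<open>Gamma_tilde n #>
  x\<close> of \<open>x \<in> \<Delta>\<^sub>m\<close> depends only on the residue of
  \<open>x\<close> modulo \<open>p\<^sup>2\<^sup>m\<close>.
\<close>

section \<open>The \<open>p\<close>-adic integers\<close>

text \<open>The reduction to subsets works because structure constants are cardinalities:
  coefficients of a product are sums of nonnegative integers, so nothing cancels. It depends on
  finiteness, since sums over infinite sets and cardinalities of infinite sets default to 0. The
  Hecke ring of the matrix pair (\<open>Gamma n\<close>, \<open>Delta n\<close>) is commutative, so
  matrix parts alone cannot separate the two products; the vector part has to decide. In (A, a)(B,
  b) the vector b is moved by A, whereas a is only scaled by \<mu>(B). Pairing the vector part with
  AB e turns the first contribution into a multiple of \<mu>(A), by invariance of the form, and the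
  second into a multiple of \<mu>(B). With levels k, l in this order the first can have valuation
  exactly k. With l, k it is divisible by p^(k+1) because k < l, and the second by p^k; one further
  factor p comes from choosing AB e divisible by p, which is where k > 0 enters.\<close>

lemma residue_eqI: "(\<And>i. residue x i = residue y i) \<Longrightarrow> x = (y :: 'p :: prime_card padic_int)"
  by (metis ext residue_inject)

lemma residue_diff:
  "residue (x - y :: 'p :: prime_card padic_int) i = (residue x i - residue y i) mod int CARD('p) ^ i"
  by transfer simp

lemma residue_one: "residue (1 :: 'p :: prime_card padic_int) i = 1 mod int CARD('p) ^ i"
  by transfer simp

lemma residue_of_nat: "residue (of_nat m :: 'p :: prime_card padic_int) i = int m mod int CARD('p) ^ i"
proof (induction m)
  case 0
  show ?case by (simp add: zero_padic_int.rep_eq)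
next
  case (Suc m)
  then show ?case by (simp add: plus_padic_int.rep_eq residue_one mod_simps)
qed

text \<open>If the residue at N vanishes, all later residues are divisible by p^N. Their quotients,
  with the index shifted by N to make up for the lost precision, again form a coherent
  sequence.\<close>

lemma power_dvd_padic_int_iff:
  fixes x :: "'p :: prime_card padic_int"
  shows "of_nat CARD('p) ^ N dvd x \<longleftrightarrow> residue x N = 0"
proof
  assume "of_nat CARD('p) ^ N dvd x"
  then obtain y where "x = of_nat (CARD('p) ^ N) * y" by auto
  then show "residue x N = 0" by (simp add: residue_mult residue_of_nat del: of_nat_power) simp
next
  let ?p = "int CARD('p)"
  assume x: "residue x N = 0"
  define y where "y i = residue x (i + N) div ?p ^ N" for i
  have "y (Suc i) mod ?p ^ i = y i" for i
  proof -
    have "y (Suc i) mod ?p ^ i = residue x (Suc i + N) mod (?p ^ N * ?p ^ i) div ?p ^ N"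
      using p_gt_1[where 'p = 'p] by (simp add: y_def zmod_zmult2_eq)
    also have "residue x (Suc i + N) mod (?p ^ N * ?p ^ i) = residue x (i + N)"
      using residue_mod[of "i + N" "Suc i + N" x] by (simp add: power_add mult.commute)
    finally show ?thesis by (simp add: y_def)
  qed
  then have y: "residue (Abs_padic_int y :: 'p padic_int) = y"
    by (intro Abs_padic_int_inverse) simp
  have "x = of_nat (CARD('p) ^ N) * (Abs_padic_int y :: 'p padic_int)"
  proof (rule residue_eqI)
    fix i
    have "?p ^ N dvd residue x (i + N)"
      using residue_mod[of N "i + N" x] x by (simp add: dvd_eq_mod_eq_0)
    then have "?p ^ N * y i = residue x (i + N)" by (simp add: y_def)
    then have "residue x i = ?p ^ N * y i mod ?p ^ i"
      using residue_mod[of i "i + N" x] by simp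
    also have "\<dots> = residue (of_nat (CARD('p) ^ N) * (Abs_padic_int y :: 'p padic_int)) i"
      by (simp add: residue_mult residue_of_nat y mod_simps del: of_nat_power) simp
    finally show "residue x i = \<dots>" .
  qed
  then show "of_nat CARD('p) ^ N dvd x" by simp
qed

text \<open>A nonzero residue modulo p makes every residue invertible modulo its p^i. The inverses
  cohere because inverses modulo p^i are unique.\<close>

lemma padic_int_unit:
  fixes x :: "'p :: prime_card padic_int"
  assumes "residue x 1 \<noteq> 0"
  shows "x dvd 1"
proof -
  let ?p = "int CARD('p)"
  define y where "y i = modular_inverse (?p ^ i) (residue x i)" for i
  have "\<not> ?p dvd residue x i" if "i > 0" for i
    using residue_mod[of 1 i x] that assms by (simp add: dvd_eq_mod_eq_0)
  then have "coprime (residue x i) (?p ^ i)" for i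
    using prime_imp_coprime[OF prime_card_int[where 'a = 'p]]
    by (cases "i = 0") (auto simp: coprime_commute)
  then have inv: "[residue x i * y i = 1] (mod ?p ^ i)" for i
    unfolding y_def by (rule cong_modular_inverse1)
  have "y (Suc i) mod ?p ^ i = y i" for i
  proof -
    have "[residue x (Suc i) * y (Suc i) = 1] (mod ?p ^ i)"
      using inv[of "Suc i"] by (rule cong_dvd_modulus) simp
    then have "[residue x i * (y (Suc i) mod ?p ^ i) = 1] (mod ?p ^ i)"
      unfolding cong_def by (metis mod_mult_eq residue_Suc mod_mod_trivial)
    then have "modular_inverse (?p ^ i) (residue x i) = y (Suc i) mod ?p ^ i"
      using p_gt_1[where 'p = 'p] by (intro modular_inverse_int_eqI) auto
    then show ?thesis by (simp add: y_def)
  qed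
  then have y: "residue (Abs_padic_int y :: 'p padic_int) = y"
    by (intro Abs_padic_int_inverse) simp
  have "x * Abs_padic_int y = 1"
    using inv by (intro residue_eqI) (simp add: residue_mult residue_one y cong_def)
  then show ?thesis by (metis dvd_triv_left)
qed

lemma padic_int_factorization:
  fixes x :: "'p :: prime_card padic_int"
  assumes "x \<noteq> 0"
  obtains v u where "u dvd 1" "x = of_nat CARD('p) ^ v * u"
proof -
  let ?p = "of_nat CARD('p) :: 'p padic_int"
  define i where "i = (LEAST i. residue x i \<noteq> 0)"
  have i: "residue x i \<noteq> 0"
    unfolding i_def by (rule LeastI_ex) (use assms in \<open>simp add: padic_int_eq_0_iff\<close>)
  \<comment> \<open>The modulus at index 0 is 1, so the least index with a nonzero residue is a
    successor, and its predecessor is the exponent.\<close>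
  have "residue x 0 = 0"
    using residue_mod_same[of x 0] by simp
  with i obtain v where v: "i = Suc v" by (cases i) auto
  then have "residue x v = 0"
    using not_less_Least[of v "\<lambda>i. residue x i \<noteq> 0"] by (auto simp: i_def)
  then obtain u where u: "x = ?p ^ v * u"
    unfolding power_dvd_padic_int_iff[symmetric] by blast
  have "residue u 1 \<noteq> 0"
  proof
    assume "residue u 1 = 0"
    then have "?p dvd u" using power_dvd_padic_int_iff[of 1 u] by simp
    then have "?p ^ i dvd x" using u v by (simp add: mult.commute)
    then show False using i by (simp add: power_dvd_padic_int_iff)
  qed
  then show thesis using that u padic_int_unit by blast
qed

section \<open>The ring of integers inside its field of fractions\<close>

lemma padic_integers_0 [simp]: "0 \<in> padic_integers"
  and padic_integers_1 [simp]: "1 \<in> padic_integers"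
  unfolding padic_integers_def by (auto intro: range_eqI[of _ _ 0] range_eqI[of _ _ 1])

lemma padic_integers_add [intro]: "x \<in> padic_integers \<Longrightarrow> y \<in> padic_integers \<Longrightarrow> x + y \<in> padic_integers"
  and padic_integers_diff [intro]: "x \<in> padic_integers \<Longrightarrow> y \<in> padic_integers \<Longrightarrow> x - y \<in> padic_integers"
  and padic_integers_mult [intro]: "x \<in> padic_integers \<Longrightarrow> y \<in> padic_integers \<Longrightarrow> x * y \<in> padic_integers"
  and padic_integers_uminus [intro]: "x \<in> padic_integers \<Longrightarrow> - x \<in> padic_integers"
  unfolding padic_integers_def
  by (auto simp flip: to_fract_add to_fract_diff to_fract_mult to_fract_uminus)

lemma padic_integers_sum: "(\<And>i. i \<in> A \<Longrightarrow> f i \<in> padic_integers) \<Longrightarrow> sum f A \<in> padic_integers"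
  by (induction A rule: infinite_finite_induct) auto

lemmas padic_integers_closed = padic_integers_add padic_integers_diff padic_integers_mult
  padic_integers_uminus padic_integers_sum

lemma padic_integers_power: "x \<in> padic_integers \<Longrightarrow> x ^ m \<in> padic_integers"
  by (induction m) auto

lemma to_fract_of_nat: "to_fract (of_nat m) = of_nat m"
  by (induction m) simp_all

lemma padic_integers_of_nat [simp]: "of_nat m \<in> padic_integers"
  unfolding padic_integers_def by (metis rangeI to_fract_of_nat)

abbreviation prime_elt :: "'p :: prime_card padic" where
  "prime_elt \<equiv> of_nat CARD('p)"

lemma prime_elt_nonzero: "(of_nat CARD('p) :: 'p :: prime_card padic) \<noteq> 0"
proof -
  \<comment> \<open>Index 2 is the first at which the residue of p is nonzero.\<close>
  have "residue (of_nat CARD('p) :: 'p padic_int) 2 \<noteq> 0"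
    using p_gt_1[where 'p = 'p] by (simp add: residue_of_nat power2_eq_square)
  then have "(of_nat CARD('p) :: 'p padic_int) \<noteq> 0"
    by (auto simp: padic_int_eq_0_iff)
  then show ?thesis by (metis to_fract_of_nat to_fract_eq_0_iff)
qed

text \<open>The contradictions about divisibility by p, both for uniqueness of the valuation and for
  the witness, end here: otherwise p would divide 1 and the residue of 1 modulo p would be
  0.\<close>

lemma inverse_prime_elt_notin: "inverse (of_nat CARD('p)) \<notin> (padic_integers :: 'p :: prime_card padic set)"
proof
  assume "inverse (of_nat CARD('p)) \<in> (padic_integers :: 'p padic set)"
  then obtain y :: "'p padic_int" where "inverse (of_nat CARD('p)) = to_fract y"
    by (auto simp: padic_integers_def)
  then have "1 = of_nat CARD('p) * to_fract y"
    using prime_elt_nonzero[where 'p = 'p] by (metis right_inverse)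
  then have "1 = of_nat CARD('p) * y"
    by (metis to_fract_of_nat to_fract_1 to_fract_eq_iff to_fract_mult)
  then have "of_nat CARD('p) ^ 1 dvd (1 :: 'p padic_int)" by (metis dvd_triv_left power_one_right)
  then have "residue (1 :: 'p padic_int) 1 = 0" by (simp only: power_dvd_padic_int_iff)
  then show False using p_gt_1[where 'p = 'p] by (simp add: residue_one)
qed

section \<open>Units and the valuation\<close>

definition padic_units :: "'p :: prime_card padic set" where
  "padic_units = {u. u \<noteq> 0 \<and> u \<in> padic_integers \<and> inverse u \<in> padic_integers}"

lemma padic_units_iff: "u \<in> padic_units \<longleftrightarrow> (\<exists>w :: 'p :: prime_card padic_int. w dvd 1 \<and> u = to_fract w)"
proof
  assume u: "u \<in> padic_units"
  then obtain w w' where w: "u = to_fract w" "inverse u = to_fract w'"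
    by (auto simp: padic_units_def padic_integers_def)
  have "u * inverse u = 1" using u by (simp add: padic_units_def)
  then have "w * w' = 1" using w by (metis to_fract_1 to_fract_eq_iff to_fract_mult)
  then show "\<exists>w. w dvd 1 \<and> u = to_fract w" using w by (metis dvd_triv_left)
next
  assume "\<exists>w. w dvd 1 \<and> u = to_fract w"
  then obtain w w' where w: "u = to_fract w" "1 = w * w'" by auto
  then have "u * to_fract w' = 1" by (metis to_fract_1 to_fract_mult)
  then have "u \<noteq> 0" "inverse u = to_fract w'" by (auto intro: inverse_unique)
  then show "u \<in> padic_units" using w by (auto simp: padic_units_def padic_integers_def)
qed

lemma padic_units_mult: "u \<in> padic_units \<Longrightarrow> w \<in> padic_units \<Longrightarrow> u * w \<in> padic_units"
  by (auto simp: padic_units_def)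

lemma padic_units_1 [simp]: "1 \<in> padic_units"
  by (simp add: padic_units_def)

text \<open>If v' > v, cancelling p^v and the unit u exhibits the inverse of p as an integer.
  Applied in both directions this gives uniqueness of the exponent.\<close>

lemma prime_powi_unit_unique:
  assumes u: "u \<in> padic_units" "w \<in> padic_units"
    and eq: "prime_elt powi v * u = prime_elt powi v' * w"
  shows "v' \<le> v"
proof (rule ccontr)
  let ?p = "prime_elt :: 'a padic"
  assume "\<not> v' \<le> v"
  then obtain d where d: "v' = v + 1 + int d"
    by (metis add.commute add.left_commute not_le zless_iff_Suc_zadd of_nat_Suc)
  have p: "?p \<noteq> 0" by (rule prime_elt_nonzero)
  have "u = ?p * (?p ^ d * w)"
    using eq p unfolding d by (simp add: power_int_add mult.assoc)
  then have "inverse ?p = ?p ^ d * w * inverse u"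
    using p u by (simp add: padic_units_def field_simps)
  also have "\<dots> \<in> padic_integers"
    using u by (intro padic_integers_mult padic_integers_power) (auto simp: padic_units_def)
  finally show False using inverse_prime_elt_notin by blast
qed

lemma padic_val_eqI:
  assumes u: "u \<in> padic_units" and x: "x = prime_elt powi v * u"
  shows "padic_val x = v"
  unfolding padic_val_def
proof (rule the_equality)
  show "\<exists>u. u dvd 1 \<and> x = prime_elt powi v * to_fract u"
    using u x unfolding padic_units_iff by auto
next
  fix v' assume "\<exists>u. u dvd 1 \<and> x = prime_elt powi v' * to_fract u"
  then obtain w where w: "w \<in> padic_units" "x = prime_elt powi v' * w"
    by (auto simp: padic_units_iff)
  show "v' = v"
    using prime_powi_unit_unique[OF u w(1), of v v'] prime_powi_unit_unique[OF w(1) u, of v' v] w(2) x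
    by simp
qed

text \<open>This trades the definite description in \<open>padic_val\<close> for an explicit
  factorization, which multiplies easily.\<close>

lemma padic_val_eq_iff:
  assumes "x \<in> padic_integers" "x \<noteq> 0"
  shows "padic_val x = int k \<longleftrightarrow> (\<exists>u \<in> padic_units. x = prime_elt ^ k * u)"
proof
  obtain y :: "'a padic_int" where y: "x = to_fract y" "y \<noteq> 0"
    using assms by (auto simp: padic_integers_def)
  obtain v u where "u dvd 1" and vu: "y = of_nat CARD('a) ^ v * u"
    by (rule padic_int_factorization[OF y(2)])
  then have u: "to_fract u \<in> padic_units" by (auto simp: padic_units_iff)
  have "to_fract (z ^ v) = to_fract z ^ v" for z :: "'a padic_int"
    by (induction v) simp_all
  with y vu have x: "x = prime_elt ^ v * to_fract u" by (simp add: to_fract_of_nat)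
  with u have "padic_val x = int v" by (intro padic_val_eqI) auto
  moreover assume "padic_val x = int k"
  ultimately show "\<exists>u \<in> padic_units. x = prime_elt ^ k * u" using u x by auto
next
  assume "\<exists>u \<in> padic_units. x = prime_elt ^ k * u"
  then show "padic_val x = int k" by (auto intro: padic_val_eqI)
qed

text \<open>Unspecified outside \<open>padic_integers\<close>.\<close>

definition padic_residue :: "nat \<Rightarrow> 'p :: prime_card padic \<Rightarrow> int" where
  "padic_residue N x = residue (inv_into UNIV to_fract x) N"

lemma padic_residue_range: "padic_residue N (x :: 'p :: prime_card padic) \<in> {0..<int CARD('p) ^ N}"
proof -
  have "0 < int CARD('p) ^ N" using p_gt_1[where 'p = 'p] by simp
  then have "residue (y :: 'p padic_int) N \<in> {0..<int CARD('p) ^ N}" for y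
    using pos_mod_sign pos_mod_bound residue_mod_same[of y N] by (metis atLeastLessThan_iff)
  then show ?thesis unfolding padic_residue_def .
qed

lemma padic_residue_eqD:
  fixes x y :: "'p :: prime_card padic"
  assumes "x \<in> padic_integers" "y \<in> padic_integers" "padic_residue N x = padic_residue N y"
  shows "\<exists>z \<in> padic_integers. x - y = prime_elt ^ N * z"
proof -
  obtain a b where ab: "x = to_fract a" "y = to_fract b"
    using assms(1,2) unfolding padic_integers_def by blast
  have "inj (to_fract :: 'p padic_int \<Rightarrow> _)" by (auto intro: injI)
  then have "residue (a - b) N = 0"
    using assms ab by (simp add: padic_residue_def residue_diff)
  then obtain c where "a - b = of_nat CARD('p) ^ N * c"
    unfolding power_dvd_padic_int_iff[symmetric] by blast
  then have "x - y = to_fract (of_nat (CARD('p) ^ N) * c)"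
    using ab by (metis to_fract_diff of_nat_power)
  then have "x - y = prime_elt ^ N * to_fract c"
    unfolding to_fract_mult to_fract_of_nat by simp
  then show ?thesis by (auto simp: padic_integers_def)
qed

section \<open>Products of double cosets\<close>

context group
begin

lemma mem_double_coset:
  "x \<in> double_coset G H a \<longleftrightarrow> (\<exists>h \<in> H. \<exists>h' \<in> H. x = h \<otimes> a \<otimes> h')"
  by (auto simp: double_coset_def set_mult_def)

lemma self_mem_double_coset:
  assumes "subgroup H G" "a \<in> carrier G"
  shows "a \<in> double_coset G H a"
  unfolding mem_double_coset
  using assms subgroup.one_closed by (intro bexI[of _ \<one>]) auto

lemma double_coset_eqI:
  assumes H: "subgroup H G" and a: "a \<in> carrier G" and x: "x \<in> double_coset G H a"
  shows "double_coset G H x = double_coset G H a"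
proof -
  obtain h h' where h: "h \<in> H" "h' \<in> H" "x = h \<otimes> a \<otimes> h'"
    using x by (auto simp: mem_double_coset)
  have hC: "h \<in> carrier G" "h' \<in> carrier G" using h subgroup.mem_carrier[OF H] by auto
  have xC: "x \<in> carrier G" using h hC a by simp
  \<comment> \<open>Stated for arbitrary representatives because it is applied twice: once to x and
    a, and once with the roles exchanged, a being recovered from x by inverses in H.\<close>
  have sub: "double_coset G H y \<subseteq> double_coset G H z"
    if y: "k \<in> H" "k' \<in> H" "y = k \<otimes> z \<otimes> k'" and z: "z \<in> carrier G" for y z k k'
  proof
    fix w assume "w \<in> double_coset G H y"
    then obtain j j' where w: "j \<in> H" "j' \<in> H" "w = j \<otimes> y \<otimes> j'" by (auto simp: mem_double_coset)
    have "j \<in> carrier G" "j' \<in> carrier G" "k \<in> carrier G" "k' \<in> carrier G"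
      using w y subgroup.mem_carrier[OF H] by auto
    then have "w = (j \<otimes> k) \<otimes> z \<otimes> (k' \<otimes> j')" using w y z by (simp add: m_assoc)
    then show "w \<in> double_coset G H z"
      unfolding mem_double_coset using w y subgroup.m_closed[OF H] by blast
  qed
  have "inv h \<otimes> x \<otimes> inv h' = (inv h \<otimes> h) \<otimes> a \<otimes> (h' \<otimes> inv h')"
    using h(3) hC a by (simp only: m_assoc m_closed inv_closed)
  then have "a = inv h \<otimes> x \<otimes> inv h'" using hC a by simp
  with sub[of "inv h" "inv h'" a x] sub[OF h a] show ?thesis
    using h xC subgroup.m_inv_closed[OF H] by blast
qed

text \<open>HxH = (Hx)H is determined by the coset Hx.\<close>

lemma finite_double_cosets:
  assumes "S \<subseteq> carrier G" and fin: "finite ((\<lambda>x. H #> x) ` S)"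
  shows "finite (double_coset G H ` S)"
proof -
  have "double_coset G H ` S = (\<lambda>C. C <#> H) ` (\<lambda>x. H #> x) ` S"
    by (simp add: double_coset_def image_image r_coset_eq_set_mult)
  with fin show ?thesis by simp
qed

text \<open>For a subgroup H these sets are the unions of double cosets, hence the possible supports
  of sums of basis elements.\<close>

definition biinvariant :: "'a set \<Rightarrow> 'a set \<Rightarrow> bool" where
  "biinvariant H S \<longleftrightarrow> S \<subseteq> carrier G \<and> (\<forall>h \<in> H. \<forall>s \<in> S. h \<otimes> s \<in> S \<and> s \<otimes> h \<in> S)"

lemma biinvariant_double_coset_subset:
  "biinvariant H S \<Longrightarrow> a \<in> S \<Longrightarrow> double_coset G H a \<subseteq> S"
  by (auto simp: biinvariant_def mem_double_coset)

lemma biinvariant_set_mult: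
  assumes H: "subgroup H G" and S: "biinvariant H S" and T: "biinvariant H T"
  shows "biinvariant H (S <#> T)"
  unfolding biinvariant_def
proof (intro conjI ballI)
  show "S <#> T \<subseteq> carrier G"
    using S T by (intro set_mult_closed) (auto simp: biinvariant_def)
  fix h x assume h: "h \<in> H" and "x \<in> S <#> T"
  then obtain s t where st: "s \<in> S" "t \<in> T" "x = s \<otimes> t" by (auto simp: set_mult_def)
  then have "h \<in> carrier G" "s \<in> carrier G" "t \<in> carrier G"
    using S T h subgroup.mem_carrier[OF H] by (auto simp: biinvariant_def)
  then have "h \<otimes> x = (h \<otimes> s) \<otimes> t" "x \<otimes> h = s \<otimes> (t \<otimes> h)" using st by (auto simp: m_assoc)
  moreover have "h \<otimes> s \<in> S" "t \<otimes> h \<in> T" using S T st h by (auto simp: biinvariant_def)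
  ultimately show "h \<otimes> x \<in> S <#> T" "x \<otimes> h \<in> S <#> T"
    using st by (auto simp only: set_mult_def)
qed

lemma hecke_coeff_zero:
  assumes "Y \<subseteq> carrier G" "g \<in> carrier G" "g \<notin> X <#> Y"
  shows "hecke_coeff G H X Y g = 0"
proof -
  have "g \<otimes> inv d \<notin> X" if "d \<in> Y" for d
  proof
    assume "g \<otimes> inv d \<in> X"
    moreover have "g = (g \<otimes> inv d) \<otimes> d" using assms that by (simp add: m_assoc subset_iff)
    ultimately show False using assms(3) that by (auto simp: set_mult_def)
  qed
  then have "{H #> d |d. d \<in> Y \<and> g \<otimes> inv d \<in> X} = {}" by blast
  then show ?thesis by (simp only: hecke_coeff_def card.empty)
qed

text \<open>The coset of y itself is counted. Finiteness ensures that \<open>card\<close> sees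
  it.\<close>

lemma hecke_coeff_nonzero:
  assumes "Y \<subseteq> carrier G" "x \<in> X" "y \<in> Y" "x \<in> carrier G" "finite ((\<lambda>d. H #> d) ` Y)"
  shows "hecke_coeff G H X Y (x \<otimes> y) \<noteq> 0"
proof -
  have "{H #> d |d. d \<in> Y \<and> x \<otimes> y \<otimes> inv d \<in> X} \<subseteq> (\<lambda>d. H #> d) ` Y" by auto
  then have "finite {H #> d |d. d \<in> Y \<and> x \<otimes> y \<otimes> inv d \<in> X}" using assms(5) finite_subset by blast
  moreover have "x \<otimes> y \<otimes> inv y = x" using assms by (simp add: m_assoc subset_iff)
  then have "H #> y \<in> {H #> d |d. d \<in> Y \<and> x \<otimes> y \<otimes> inv d \<in> X}" using assms by auto
  ultimately show ?thesis unfolding hecke_coeff_def card_eq_0_iff by blast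
qed

text \<open>The finiteness test records that the defining sum is 0 by default when infinitely many
  structure constants are nonzero.\<close>

lemma lookup_hecke_basis_mult:
  "Poly_Mapping.lookup (hecke_basis_mult G H D X Y) Z =
    (if Z \<in> double_cosets G H D \<and>
        finite {Z \<in> double_cosets G H D. hecke_coeff G H X Y (SOME g. g \<in> Z) \<noteq> 0}
     then int (hecke_coeff G H X Y (SOME g. g \<in> Z)) else 0)"
proof -
  let ?A = "{Z \<in> double_cosets G H D. hecke_coeff G H X Y (SOME g. g \<in> Z) \<noteq> 0}"
  have "Poly_Mapping.lookup (hecke_basis_mult G H D X Y) Z
      = (\<Sum>Z' \<in> ?A. if Z' = Z then int (hecke_coeff G H X Y (SOME g. g \<in> Z')) else 0)"
    unfolding hecke_basis_mult_def lookup_sum by (intro sum.cong) simp_all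
  then show ?thesis by (cases "finite ?A") (auto simp: sum.delta)
qed

lemma lookup_hecke_mult_nonzero_iff:
  assumes H: "subgroup H G" and S: "biinvariant H S" and T: "biinvariant H T"
    and fin: "finite ((\<lambda>x. H #> x) ` S)" "finite ((\<lambda>x. H #> x) ` T)" "finite ((\<lambda>x. H #> x) ` (S <#> T))"
    and D: "D \<subseteq> carrier G" and g: "g \<in> D"
  shows "Poly_Mapping.lookup
      ((\<Sum>X \<in> double_coset G H ` S. frag_of X) \<otimes>\<^bsub>hecke_ring G H D\<^esub>
       (\<Sum>Y \<in> double_coset G H ` T. frag_of Y)) (double_coset G H g) \<noteq> 0
    \<longleftrightarrow> g \<in> S <#> T"
proof -
  let ?dc = "double_coset G H" and ?P = "double_coset G H ` S" and ?Q = "double_coset G H ` T"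
  have SC: "S \<subseteq> carrier G" and TC: "T \<subseteq> carrier G" using S T by (auto simp: biinvariant_def)
  have gC: "g \<in> carrier G" using g D by auto
  have ST: "biinvariant H (S <#> T)" by (rule biinvariant_set_mult[OF H S T])
  have STC: "S <#> T \<subseteq> carrier G" using ST by (simp add: biinvariant_def)
  have finP: "finite ?P" by (rule finite_double_cosets[OF SC fin(1)])
  have finQ: "finite ?Q" by (rule finite_double_cosets[OF TC fin(2)])
  have finST: "finite (?dc ` (S <#> T))" by (rule finite_double_cosets[OF STC fin(3)])
  \<comment> \<open>The structure constant is read off at a chosen representative, not at g;
    biinvariance of the product set lets the two be exchanged.\<close>
  define g' where "g' = (SOME x. x \<in> ?dc g)"
  have g'_mem: "g' \<in> ?dc g"
    unfolding g'_def using self_mem_double_coset[OF H gC] by (rule someI)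
  then have g'C: "g' \<in> carrier G"
    using gC subgroup.mem_carrier[OF H] by (auto simp: mem_double_coset)
  have "?dc g' = ?dc g" by (rule double_coset_eqI[OF H gC g'_mem])
  then have g_mem: "g \<in> ?dc g'" using self_mem_double_coset[OF H gC] by simp
  have g'_iff: "g' \<in> S <#> T \<longleftrightarrow> g \<in> S <#> T"
    using biinvariant_double_coset_subset[OF ST] g_mem g'_mem by blast
  have PS: "X \<subseteq> S" if "X \<in> ?P" for X
    using that biinvariant_double_coset_subset[OF S] by auto
  have QT: "Y \<subseteq> T" if "Y \<in> ?Q" for Y
    using that biinvariant_double_coset_subset[OF T] by auto
  \<comment> \<open>A nonzero structure constant puts the chosen representative into the product
    set, so each such Z is one of the finitely many double cosets in \<open>S <#> T\<close>.\<close>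
  have finZ: "finite {Z \<in> double_cosets G H D. hecke_coeff G H X Y (SOME g. g \<in> Z) \<noteq> 0}"
    if XY: "X \<in> ?P" "Y \<in> ?Q" for X Y
  proof (rule finite_subset[OF _ finST], rule subsetI)
    fix Z assume "Z \<in> {Z \<in> double_cosets G H D. hecke_coeff G H X Y (SOME g. g \<in> Z) \<noteq> 0}"
    then obtain d where d: "d \<in> D" "Z = ?dc d"
      and nz: "hecke_coeff G H X Y (SOME g. g \<in> Z) \<noteq> 0" by (auto simp: double_cosets_def)
    define z where "z = (SOME g. g \<in> Z)"
    have dC: "d \<in> carrier G" using d D by auto
    have z: "z \<in> ?dc d" unfolding z_def d using self_mem_double_coset[OF H dC] by (rule someI)
    have "z \<in> carrier G"
      using z dC subgroup.mem_carrier[OF H] by (auto simp: mem_double_coset)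
    then have "z \<in> X <#> Y"
      using hecke_coeff_zero[of Y z X H] nz QT[OF XY(2)] TC unfolding z_def by blast
    then have "z \<in> S <#> T" using PS[OF XY(1)] QT[OF XY(2)] by (auto simp: set_mult_def)
    moreover have "Z = ?dc z" using double_coset_eqI[OF H dC z] d by simp
    ultimately show "Z \<in> ?dc ` (S <#> T)" by blast
  qed
  have "(\<Sum>X \<in> ?P. frag_of X) \<otimes>\<^bsub>hecke_ring G H D\<^esub> (\<Sum>Y \<in> ?Q. frag_of Y)
      = (\<Sum>X \<in> ?P. \<Sum>Y \<in> ?Q. hecke_basis_mult G H D X Y)"
    using finP finQ by (simp add: hecke_ring_def frag_extend_sum)
  then have "Poly_Mapping.lookup ((\<Sum>X \<in> ?P. frag_of X) \<otimes>\<^bsub>hecke_ring G H D\<^esub> (\<Sum>Y \<in> ?Q. frag_of Y)) (?dc g)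
      = (\<Sum>X \<in> ?P. \<Sum>Y \<in> ?Q. Poly_Mapping.lookup (hecke_basis_mult G H D X Y) (?dc g))"
    by (simp add: lookup_sum)
  also have "\<dots> = (\<Sum>X \<in> ?P. \<Sum>Y \<in> ?Q. int (hecke_coeff G H X Y g'))"
    using finZ g by (intro sum.cong refl) (auto simp: lookup_hecke_basis_mult g'_def double_cosets_def)
  \<comment> \<open>Here the absence of cancellation is used: a finite sum of nonnegative terms
    vanishes only if every term does.\<close>
  also have "\<dots> \<noteq> 0 \<longleftrightarrow> (\<exists>X \<in> ?P. \<exists>Y \<in> ?Q. hecke_coeff G H X Y g' \<noteq> 0)"
    using finP finQ by (simp add: sum_nonneg_eq_0_iff sum_nonneg flip: of_nat_sum) 
  also have "\<dots> \<longleftrightarrow> g' \<in> S <#> T"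
  proof
    assume "\<exists>X \<in> ?P. \<exists>Y \<in> ?Q. hecke_coeff G H X Y g' \<noteq> 0"
    then obtain X Y where XY: "X \<in> ?P" "Y \<in> ?Q" "hecke_coeff G H X Y g' \<noteq> 0" by blast
    have "g' \<in> X <#> Y"
      using hecke_coeff_zero[of Y g' X H] XY(3) order_trans[OF QT[OF XY(2)] TC] g'C by linarith
    then show "g' \<in> S <#> T" using PS[OF XY(1)] QT[OF XY(2)] by (auto simp: set_mult_def)
  next
    assume "g' \<in> S <#> T"
    then obtain s t where st: "s \<in> S" "t \<in> T" "g' = s \<otimes> t" by (auto simp: set_mult_def)
    have "?dc t \<subseteq> T" using QT st by blast
    then have "finite ((\<lambda>d. H #> d) ` ?dc t)" using fin(2) by (meson finite_subset image_mono)
    then have "hecke_coeff G H (?dc s) (?dc t) g' \<noteq> 0"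
      unfolding st(3) using \<open>?dc t \<subseteq> T\<close> SC TC st self_mem_double_coset[OF H]
      by (intro hecke_coeff_nonzero) auto
    then show "\<exists>X \<in> ?P. \<exists>Y \<in> ?Q. hecke_coeff G H X Y g' \<noteq> 0" using st by blast
  qed
  finally show ?thesis using g'_iff by simp
qed

end

section \<open>Symplectic similitudes\<close>

text \<open>The Kronecker product of a 2 by 2 matrix with the identity of size n. Such matrices
  multiply like 2 by 2 matrices, and both \<open>symp_J n\<close> and the matrices of the witness
  have this form, so computations with them stay independent of n.\<close>

definition scalar_blocks :: "nat \<Rightarrow> 'a :: comm_ring_1 \<Rightarrow> 'a \<Rightarrow> 'a \<Rightarrow> 'a \<Rightarrow> 'a mat" where
  "scalar_blocks n a b c d =
    four_block_mat (a \<cdot>\<^sub>m 1\<^sub>m n) (b \<cdot>\<^sub>m 1\<^sub>m n) (c \<cdot>\<^sub>m 1\<^sub>m n) (d \<cdot>\<^sub>m 1\<^sub>m n)"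

lemma smult_smult_mat: "a \<cdot>\<^sub>m (b \<cdot>\<^sub>m A) = (a * b :: 'a :: semigroup_mult) \<cdot>\<^sub>m A"
  by (rule eq_matI) (simp_all add: mult.assoc)

lemma smult_one_mat: "(1 :: 'a :: monoid_mult) \<cdot>\<^sub>m A = A"
  by (rule eq_matI) simp_all

lemma smult_mat_mult_vec:
  "v \<in> carrier_vec (dim_col A) \<Longrightarrow> (k \<cdot>\<^sub>m A) *\<^sub>v v = (k :: 'a :: comm_ring_1) \<cdot>\<^sub>v (A *\<^sub>v v)"
  by (rule eq_vecI) simp_all

lemma scalar_blocks_carrier [simp]: "scalar_blocks n a b c d \<in> carrier_mat (2 * n) (2 * n)"
  unfolding scalar_blocks_def mult_2 by (rule four_block_carrier_mat) simp_all

lemma index_scalar_blocks: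
  assumes "i < 2 * n" "j < 2 * n"
  shows "scalar_blocks n a b c d $$ (i, j) =
    (if i < n then if j < n then if i = j then a else 0 else if i + n = j then b else 0
     else if j < n then if i = j + n then c else 0 else if i = j then d else 0)"
  using assms unfolding scalar_blocks_def by (subst index_mat_four_block) auto

lemma scalar_blocks_mult:
  "scalar_blocks n a b c d * scalar_blocks n a' b' c' d' =
   scalar_blocks n (a * a' + b * c') (a * b' + b * d') (c * a' + d * c') (c * b' + d * d')"
proof -
  have "(x \<cdot>\<^sub>m 1\<^sub>m n) * (y \<cdot>\<^sub>m 1\<^sub>m n) + (z \<cdot>\<^sub>m 1\<^sub>m n) * (w \<cdot>\<^sub>m 1\<^sub>m n) = (x * y + z * w) \<cdot>\<^sub>m (1\<^sub>m n :: 'a mat)"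
    for x y z w :: 'a
    by (subst mult_smult_assoc_mat[of _ n n _ n], simp, simp, subst mult_smult_assoc_mat[of _ n n _ n])
      (auto intro!: eq_matI)
  then show ?thesis
    unfolding scalar_blocks_def by (subst mult_four_block_mat[of _ n n _ n _ n _ _ n _ n]) simp_all
qed

lemma transpose_scalar_blocks: "transpose_mat (scalar_blocks n a b c d) = scalar_blocks n a c b d"
  unfolding scalar_blocks_def
  by (subst transpose_four_block_mat[of _ n n _ n _ n]) (auto intro!: cong_four_block_mat)

lemma smult_scalar_blocks:
  "k \<cdot>\<^sub>m scalar_blocks n a b c d = scalar_blocks n (k * a) (k * b) (k * c) (k * d)"
  by (rule eq_matI) (auto simp: index_scalar_blocks carrier_matD[OF scalar_blocks_carrier])

lemma one_scalar_blocks: "1\<^sub>m (2 * n) = scalar_blocks n 1 0 0 1"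
  by (rule eq_matI) (auto simp: index_scalar_blocks carrier_matD[OF scalar_blocks_carrier])

lemma symp_J_scalar_blocks: "symp_J n = scalar_blocks n 0 1 (- 1) 0"
  unfolding symp_J_def scalar_blocks_def by (rule cong_four_block_mat) auto

lemma symp_J_carrier [simp]: "symp_J n \<in> carrier_mat (2 * n) (2 * n)"
  by (simp add: symp_J_scalar_blocks)

text \<open>With the inner dimensions fixed, the simplifier can discharge the carrier premises.\<close>

lemmas mat_closed = mult_carrier_mat[where nr = "2 * n" and n = "2 * n" and nc = "2 * n" for n]
  mult_mat_vec_carrier[where nr = "2 * n" and n = "2 * n" for n]
lemmas mat_assoc = assoc_mult_mat[where n\<^sub>1 = "2 * n" and n\<^sub>2 = "2 * n" and n\<^sub>3 = "2 * n" and n\<^sub>4 = "2 * n" for n]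
lemmas mat_vec_assoc = assoc_mult_mat_vec[where n\<^sub>1 = "2 * n" and n\<^sub>2 = "2 * n" and n\<^sub>3 = "2 * n" for n]
lemmas mat_smult = mult_smult_distrib[where nr = "2 * n" and n = "2 * n" and nc = "2 * n" for n]
  mult_smult_assoc_mat[where nr = "2 * n" and n = "2 * n" and nc = "2 * n" for n]

text \<open>The entry of J at (0, n) is 1, which makes the multiplier unique and
  \<open>similitude\<close> well defined.\<close>

lemma smult_symp_J_eq_iff:
  assumes "n \<ge> 1"
  shows "m \<cdot>\<^sub>m symp_J n = m' \<cdot>\<^sub>m symp_J n \<longleftrightarrow> m = m'"
proof
  assume "m \<cdot>\<^sub>m symp_J n = m' \<cdot>\<^sub>m symp_J n"
  then have "(m \<cdot>\<^sub>m symp_J n) $$ (0, n) = (m' \<cdot>\<^sub>m symp_J n) $$ (0, n)" by simp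
  then show "m = m'" using assms by (simp add: symp_J_scalar_blocks smult_scalar_blocks index_scalar_blocks)
qed simp

lemma similitude_eqI:
  assumes "n \<ge> 1" "transpose_mat g * symp_J n * g = m \<cdot>\<^sub>m symp_J n"
  shows "similitude n g = m"
  unfolding similitude_def using assms by (intro the_equality) (auto simp: smult_symp_J_eq_iff)

lemma GSp_carrier: "g \<in> GSp n \<Longrightarrow> g \<in> carrier_mat (2 * n) (2 * n)"
  by (simp add: GSp_def)

lemma GSp_form: "n \<ge> 1 \<Longrightarrow> g \<in> GSp n \<Longrightarrow> transpose_mat g * symp_J n * g = similitude n g \<cdot>\<^sub>m symp_J n"
  unfolding GSp_def using similitude_eqI by blast

lemma GSp_inverseE:
  assumes "g \<in> GSp n"
  obtains h where "h \<in> carrier_mat (2 * n) (2 * n)" "g * h = 1\<^sub>m (2 * n)" "h * g = 1\<^sub>m (2 * n)"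
proof -
  have g: "g \<in> carrier_mat (2 * n) (2 * n)" "invertible_mat g" using assms by (auto simp: GSp_def)
  then obtain h where h: "inverts_mat g h" "inverts_mat h g" by (auto simp: invertible_mat_def)
  have gh: "g * h = 1\<^sub>m (2 * n)" using h g by (simp add: inverts_mat_def)
  have hg: "h * g = 1\<^sub>m (dim_row h)" using h by (simp add: inverts_mat_def)
  \<comment> \<open>Invertibility comes without the size of h, so its dimensions are read off from
    the columns of the two products.\<close>
  have "dim_col h = 2 * n" using arg_cong[OF gh, of dim_col] by simp
  moreover have "dim_row h = 2 * n" using arg_cong[OF hg, of dim_col] g by simp
  ultimately show thesis using that gh hg by auto
qed

lemma transpose_form_mult:
  assumes g: "g \<in> carrier_mat (2 * n) (2 * n)" and h: "h \<in> carrier_mat (2 * n) (2 * n)"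
    and eq: "transpose_mat g * symp_J n * g = m \<cdot>\<^sub>m symp_J n"
  shows "transpose_mat (g * h) * symp_J n * (g * h) = m \<cdot>\<^sub>m (transpose_mat h * symp_J n * h)"
proof -
  have "transpose_mat (g * h) * symp_J n * (g * h) = transpose_mat h * (transpose_mat g * symp_J n * g) * h"
    using g h by (simp add: transpose_mult[of _ "2 * n" "2 * n" _ "2 * n"] mat_assoc[of _ n] mat_closed[of _ n])
  then show ?thesis using h by (simp add: eq mat_smult[of _ n] mat_closed[of _ n])
qed

text \<open>Transporting the form back along an inverse h writes J as \<mu>(g) times another matrix,
  so \<mu>(g) = 0 would force J = 0.\<close>

lemma similitude_nonzero:
  fixes g :: "'a :: field mat"
  assumes n: "n \<ge> 1" and g: "g \<in> GSp n"
  shows "similitude n g \<noteq> 0"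
proof
  assume "similitude n g = 0"
  obtain h where h: "h \<in> carrier_mat (2 * n) (2 * n)" "g * h = 1\<^sub>m (2 * n)" using GSp_inverseE[OF g] by blast
  have "1 \<cdot>\<^sub>m symp_J n = 0 \<cdot>\<^sub>m (transpose_mat h * symp_J n * h)"
    using transpose_form_mult[OF GSp_carrier[OF g] h(1) GSp_form[OF n g]] h(2) \<open>similitude n g = 0\<close>
    by (simp add: left_mult_one_mat[OF symp_J_carrier] right_mult_one_mat[OF symp_J_carrier] smult_one_mat)
  also have "\<dots> = 0 \<cdot>\<^sub>m symp_J n"
    using h by (intro eq_matI) (auto simp: carrier_matD[OF symp_J_carrier])
  finally have "(1 :: 'a) = 0" by (simp add: smult_symp_J_eq_iff[OF n])
  then show False by simp
qed

lemma GSp_mult: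
  fixes g h :: "'a :: field mat"
  assumes n: "n \<ge> 1" and g: "g \<in> GSp n" and h: "h \<in> GSp n"
  shows "g * h \<in> GSp n" "similitude n (g * h) = similitude n g * similitude n h"
proof -
  note gC = GSp_carrier[OF g] and hC = GSp_carrier[OF h]
  have eq: "transpose_mat (g * h) * symp_J n * (g * h) = (similitude n g * similitude n h) \<cdot>\<^sub>m symp_J n"
    using transpose_form_mult[OF gC hC GSp_form[OF n g]] GSp_form[OF n h] by (simp add: smult_smult_mat)
  then show "similitude n (g * h) = similitude n g * similitude n h" by (rule similitude_eqI[OF n])
  obtain g' h' where i: "g' \<in> carrier_mat (2 * n) (2 * n)" "g * g' = 1\<^sub>m (2 * n)" "g' * g = 1\<^sub>m (2 * n)"
    "h' \<in> carrier_mat (2 * n) (2 * n)" "h * h' = 1\<^sub>m (2 * n)" "h' * h = 1\<^sub>m (2 * n)"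
    using GSp_inverseE[OF g] GSp_inverseE[OF h] by metis
  have "(g * h) * (h' * g') = g * (h * h') * g'" "(h' * g') * (g * h) = h' * (g' * g) * h"
    using gC hC i(1,4) by (simp_all add: mat_assoc[of _ n] mat_closed[of _ n])
  then have "inverts_mat (g * h) (h' * g')" "inverts_mat (h' * g') (g * h)"
    using gC hC i by (simp_all add: inverts_mat_def)
  then have "invertible_mat (g * h)" using gC hC by (auto simp: invertible_mat_def)
  then show "g * h \<in> GSp n" using eq gC hC by (auto simp: GSp_def)
qed

lemma GSp_one: "n \<ge> 1 \<Longrightarrow> 1\<^sub>m (2 * n) \<in> GSp n"
  unfolding GSp_def
  by (auto simp: invertible_mat_def inverts_mat_def left_mult_one_mat[OF symp_J_carrier]
      right_mult_one_mat[OF symp_J_carrier] intro!: exI[of _ "1\<^sub>m (2 * n)"] exI[of _ 1])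

lemma GSp_inverse:
  fixes g h :: "'a :: field mat"
  assumes n: "n \<ge> 1" and g: "g \<in> GSp n" and h: "h \<in> carrier_mat (2 * n) (2 * n)"
    and gh: "g * h = 1\<^sub>m (2 * n)" and hg: "h * g = 1\<^sub>m (2 * n)"
  shows "h \<in> GSp n" "similitude n h = inverse (similitude n g)"
proof -
  let ?m = "similitude n g"
  have m: "?m \<noteq> 0" by (rule similitude_nonzero[OF n g])
  have "symp_J n = ?m \<cdot>\<^sub>m (transpose_mat h * symp_J n * h)"
    using transpose_form_mult[OF GSp_carrier[OF g] h GSp_form[OF n g]] gh
    by (simp add: left_mult_one_mat[OF symp_J_carrier] right_mult_one_mat[OF symp_J_carrier])
  then have "inverse ?m \<cdot>\<^sub>m symp_J n = inverse ?m \<cdot>\<^sub>m (?m \<cdot>\<^sub>m (transpose_mat h * symp_J n * h))" by simp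
  also have "\<dots> = transpose_mat h * symp_J n * h"
    using m by (simp add: smult_smult_mat smult_one_mat)
  finally have eq: "transpose_mat h * symp_J n * h = inverse ?m \<cdot>\<^sub>m symp_J n" by simp
  then show "similitude n h = inverse ?m" by (rule similitude_eqI[OF n])
  have "invertible_mat h"
    using gh hg h GSp_carrier[OF g] by (auto simp: invertible_mat_def inverts_mat_def intro!: exI[of _ g])
  then show "h \<in> GSp n" using eq h by (auto simp: GSp_def)
qed

text \<open>Since the inverse of J is -J, this is \<mu>(g) times the inverse of g, written without
  division; it is therefore integral whenever g is.\<close>

definition symp_adjoint :: "nat \<Rightarrow> 'a :: comm_ring_1 mat \<Rightarrow> 'a mat" where
  "symp_adjoint n g = (- 1) \<cdot>\<^sub>m symp_J n * transpose_mat g * symp_J n"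

lemma symp_adjoint_carrier: "g \<in> carrier_mat (2 * n) (2 * n) \<Longrightarrow> symp_adjoint n g \<in> carrier_mat (2 * n) (2 * n)"
  unfolding symp_adjoint_def by (simp add: mat_closed[of _ n])

lemma symp_adjoint_mult:
  assumes n: "n \<ge> 1" and g: "g \<in> GSp n"
  shows "symp_adjoint n g * g = similitude n g \<cdot>\<^sub>m 1\<^sub>m (2 * n)"
proof -
  have "symp_adjoint n g * g = ((- 1) \<cdot>\<^sub>m symp_J n) * (transpose_mat g * symp_J n * g)"
    unfolding symp_adjoint_def using GSp_carrier[OF g] by (simp add: mat_assoc[of _ n] mat_closed[of _ n])
  also have "\<dots> = similitude n g \<cdot>\<^sub>m (((- 1) \<cdot>\<^sub>m symp_J n) * symp_J n)"
    unfolding GSp_form[OF n g] by (rule mult_smult_distrib[of _ "2 * n" "2 * n" _ "2 * n"]) simp_all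
  also have "((- 1) \<cdot>\<^sub>m symp_J n) * symp_J n = (1\<^sub>m (2 * n) :: 'a mat)"
    by (simp add: symp_J_scalar_blocks smult_scalar_blocks scalar_blocks_mult one_scalar_blocks)
  finally show ?thesis .
qed

definition symp_form :: "nat \<Rightarrow> 'a :: comm_ring_1 vec \<Rightarrow> 'a vec \<Rightarrow> 'a" where
  "symp_form n x y = x \<bullet> (symp_J n *\<^sub>v y)"

lemma symp_form_GSp:
  assumes n: "n \<ge> 1" and g: "g \<in> GSp n" and x: "x \<in> carrier_vec (2 * n)" and y: "y \<in> carrier_vec (2 * n)"
  shows "symp_form n (g *\<^sub>v x) (g *\<^sub>v y) = similitude n g * symp_form n x y"
proof -
  note gC = GSp_carrier[OF g]
  define w where "w = symp_J n *\<^sub>v (g *\<^sub>v y)"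
  have w: "w \<in> carrier_vec (2 * n)" unfolding w_def using gC y by (simp add: mat_closed[of _ n])
  have "symp_form n (g *\<^sub>v x) (g *\<^sub>v y) = w \<bullet> (g *\<^sub>v x)"
    unfolding symp_form_def w_def[symmetric]
    using gC x w by (intro comm_scalar_prod[of _ "2 * n"]) (auto simp: mat_closed[of _ n])
  also have "\<dots> = (transpose_mat g *\<^sub>v w) \<bullet> x"
    using transpose_vec_mult_scalar[OF gC x w] by simp
  also have "\<dots> = x \<bullet> (transpose_mat g *\<^sub>v w)"
    using gC x w by (intro comm_scalar_prod[of _ "2 * n"]) (auto simp: mat_closed[of _ n])
  also have "transpose_mat g *\<^sub>v w = (transpose_mat g * symp_J n * g) *\<^sub>v y"
    unfolding w_def using gC y by (simp add: mat_vec_assoc[of _ n] mat_closed[of _ n])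
  also have "\<dots> = similitude n g \<cdot>\<^sub>v (symp_J n *\<^sub>v y)"
    unfolding GSp_form[OF n g] using y by (intro smult_mat_mult_vec) (simp add: carrier_matD[OF symp_J_carrier])
  finally show ?thesis
    unfolding symp_form_def using x y by (simp add: mat_closed[of _ n])
qed

section \<open>The group and its levels\<close>

lemma integral_mats_iff:
  "A \<in> integral_mats m \<longleftrightarrow> A \<in> carrier_mat m m \<and> (\<forall>i<m. \<forall>j<m. A $$ (i, j) \<in> padic_integers)"
  unfolding integral_mats_def by fastforce

lemma integral_vecs_iff:
  "v \<in> integral_vecs n \<longleftrightarrow> v \<in> carrier_vec (2 * n) \<and> (\<forall>i<2 * n. v $ i \<in> padic_integers)"
  unfolding integral_vecs_def by (auto simp: vec_set_def)

lemma integral_mats_mult: "A \<in> integral_mats m \<Longrightarrow> B \<in> integral_mats m \<Longrightarrow> A * B \<in> integral_mats m"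
  by (auto simp: integral_mats_iff scalar_prod_def intro!: padic_integers_closed)

lemma integral_mats_add: "A \<in> integral_mats m \<Longrightarrow> B \<in> integral_mats m \<Longrightarrow> A + B \<in> integral_mats m"
  by (auto simp: integral_mats_iff intro!: padic_integers_closed)

lemma integral_mats_smult: "k \<in> padic_integers \<Longrightarrow> A \<in> integral_mats m \<Longrightarrow> k \<cdot>\<^sub>m A \<in> integral_mats m"
  by (auto simp: integral_mats_iff intro!: padic_integers_closed)

lemma integral_mats_transpose: "A \<in> integral_mats m \<Longrightarrow> transpose_mat A \<in> integral_mats m"
  by (auto simp: integral_mats_iff)

lemma integral_mats_one: "1\<^sub>m m \<in> integral_mats m"
  by (auto simp: integral_mats_iff)

lemma integral_scalar_blocks:
  "a \<in> padic_integers \<Longrightarrow> b \<in> padic_integers \<Longrightarrow> c \<in> padic_integers \<Longrightarrow> d \<in> padic_integers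
    \<Longrightarrow> scalar_blocks n a b c d \<in> integral_mats (2 * n)"
  by (simp add: integral_mats_iff index_scalar_blocks)

lemma integral_symp_J: "symp_J n \<in> integral_mats (2 * n)"
  unfolding symp_J_scalar_blocks by (rule integral_scalar_blocks) auto

lemma integral_vecs_mult_mat: "A \<in> integral_mats (2 * n) \<Longrightarrow> v \<in> integral_vecs n \<Longrightarrow> A *\<^sub>v v \<in> integral_vecs n"
  by (auto simp: integral_mats_iff integral_vecs_iff scalar_prod_def intro!: padic_integers_closed)

lemma integral_vecs_add: "v \<in> integral_vecs n \<Longrightarrow> w \<in> integral_vecs n \<Longrightarrow> v + w \<in> integral_vecs n"
  by (auto simp: integral_vecs_iff intro!: padic_integers_closed)

lemma integral_vecs_diff: "v \<in> integral_vecs n \<Longrightarrow> w \<in> integral_vecs n \<Longrightarrow> v - w \<in> integral_vecs n"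
  by (auto simp: integral_vecs_iff intro!: padic_integers_closed)

lemma integral_vecs_smult: "k \<in> padic_integers \<Longrightarrow> v \<in> integral_vecs n \<Longrightarrow> k \<cdot>\<^sub>v v \<in> integral_vecs n"
  by (auto simp: integral_vecs_iff intro!: padic_integers_closed)

lemma integral_vecs_zero: "0\<^sub>v (2 * n) \<in> integral_vecs n"
  by (auto simp: integral_vecs_iff)

lemma scalar_prod_integral: "v \<in> integral_vecs n \<Longrightarrow> w \<in> integral_vecs n \<Longrightarrow> v \<bullet> w \<in> padic_integers"
  by (auto simp: integral_vecs_iff scalar_prod_def intro!: padic_integers_closed)

lemma symp_form_integral:
  "x \<in> integral_vecs n \<Longrightarrow> y \<in> integral_vecs n \<Longrightarrow> symp_form n x y \<in> padic_integers"
  unfolding symp_form_def by (rule scalar_prod_integral[OF _ integral_vecs_mult_mat[OF integral_symp_J]])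

text \<open>The multiplier is itself an entry, at (0, n), of an integral matrix, namely g transposed
  times J times g.\<close>

lemma similitude_integral:
  assumes n: "n \<ge> 1" and g: "g \<in> GSp n" "g \<in> integral_mats (2 * n)"
  shows "similitude n g \<in> padic_integers"
proof -
  have "similitude n g \<cdot>\<^sub>m symp_J n \<in> integral_mats (2 * n)"
    unfolding GSp_form[OF n g(1), symmetric]
    by (intro integral_mats_mult integral_mats_transpose integral_symp_J g)
  then have "(similitude n g \<cdot>\<^sub>m symp_J n) $$ (0, n) \<in> padic_integers"
    using n by (simp add: integral_mats_iff)
  then show ?thesis
    using n by (simp add: symp_J_scalar_blocks smult_scalar_blocks index_scalar_blocks)
qed

section \<open>The ambient group and its integral subgroup\<close>

lemma G_tilde_simps [simp]:
  "carrier (G_tilde n) = GSp n \<times> carrier_vec (2 * n)"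
  "(A, a) \<otimes>\<^bsub>G_tilde n\<^esub> (B, b) = (A * B, A *\<^sub>v b + similitude n B \<cdot>\<^sub>v a)"
  "\<one>\<^bsub>G_tilde n\<^esub> = (1\<^sub>m (2 * n), 0\<^sub>v (2 * n))"
  by (simp_all add: G_tilde_def)

text \<open>The vector part is the solution b of B a + \<mu>(A) b = 0.\<close>

lemma G_tilde_left_inverse:
  assumes n: "n \<ge> 1" and A: "A \<in> GSp n" and a: "a \<in> carrier_vec (2 * n)"
    and B: "B \<in> carrier_mat (2 * n) (2 * n)" "B * A = 1\<^sub>m (2 * n)"
  shows "(B, - inverse (similitude n A) \<cdot>\<^sub>v (B *\<^sub>v a)) \<otimes>\<^bsub>G_tilde n\<^esub> (A, a) = \<one>\<^bsub>G_tilde n\<^esub>"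
proof -
  have "B *\<^sub>v a + similitude n A \<cdot>\<^sub>v (- inverse (similitude n A) \<cdot>\<^sub>v (B *\<^sub>v a)) = 0\<^sub>v (2 * n)"
    using B(1) a similitude_nonzero[OF n A] by (intro eq_vecI) (auto simp: smult_smult_assoc)
  then show ?thesis using B by simp
qed

lemma group_G_tilde:
  assumes n: "n \<ge> 1"
  shows "group (G_tilde n :: ('p :: prime_card padic mat \<times> 'p padic vec) monoid)"
proof (rule groupI)
  let ?G = "G_tilde n :: ('p padic mat \<times> 'p padic vec) monoid"
  show "x \<otimes>\<^bsub>?G\<^esub> y \<in> carrier ?G" if "x \<in> carrier ?G" "y \<in> carrier ?G" for x y
    using that GSp_mult(1)[OF n] by (cases x; cases y) (auto simp: mat_closed[of _ n] dest: GSp_carrier)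
  show "\<one>\<^bsub>?G\<^esub> \<in> carrier ?G" using GSp_one[OF n] by simp
  show "x \<otimes>\<^bsub>?G\<^esub> y \<otimes>\<^bsub>?G\<^esub> z = x \<otimes>\<^bsub>?G\<^esub> (y \<otimes>\<^bsub>?G\<^esub> z)"
    if x: "x \<in> carrier ?G" "y \<in> carrier ?G" "z \<in> carrier ?G" for x y z
  proof -
    obtain A a B b C c where [simp]: "x = (A, a)" "y = (B, b)" "z = (C, c)" by (metis surj_pair)
    have A: "A \<in> GSp n" "B \<in> GSp n" "C \<in> GSp n" using x by auto
    have AC: "A \<in> carrier_mat (2 * n) (2 * n)" "B \<in> carrier_mat (2 * n) (2 * n)"
      "C \<in> carrier_mat (2 * n) (2 * n)" using A GSp_carrier by auto
    have a: "a \<in> carrier_vec (2 * n)" "b \<in> carrier_vec (2 * n)" "c \<in> carrier_vec (2 * n)" using x by auto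
    \<comment> \<open>By multiplicativity of \<mu>, both bracketings have vector part AB c +
      \<mu>(C) A b + \<mu>(B) \<mu>(C) a.\<close>
    have "A *\<^sub>v (B *\<^sub>v c + similitude n C \<cdot>\<^sub>v b) = A *\<^sub>v (B *\<^sub>v c) + similitude n C \<cdot>\<^sub>v (A *\<^sub>v b)"
      using AC a by (simp add: mult_add_distrib_mat_vec[of _ "2 * n" "2 * n"] mult_mat_vec[of _ "2 * n" "2 * n"]
          mat_closed[of _ n])
    moreover have "similitude n C \<cdot>\<^sub>v (A *\<^sub>v b + similitude n B \<cdot>\<^sub>v a)
        = similitude n C \<cdot>\<^sub>v (A *\<^sub>v b) + (similitude n B * similitude n C) \<cdot>\<^sub>v a"
      using AC a by (intro eq_vecI) (auto simp: algebra_simps)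
    moreover have "A *\<^sub>v (B *\<^sub>v c) \<in> carrier_vec (2 * n)" "A *\<^sub>v b \<in> carrier_vec (2 * n)"
      using AC a by (auto simp: mat_closed[of _ n])
    ultimately show ?thesis
      using AC a GSp_mult(2)[OF n A(2,3)]
      by (simp add: mat_assoc[of _ n] mat_vec_assoc[of _ n] mat_closed[of _ n] assoc_add_vec[of _ "2 * n"])
  qed
  show "\<one>\<^bsub>?G\<^esub> \<otimes>\<^bsub>?G\<^esub> x = x" if "x \<in> carrier ?G" for x
    using that by (cases x) (auto dest!: GSp_carrier)
  show "\<exists>y \<in> carrier ?G. y \<otimes>\<^bsub>?G\<^esub> x = \<one>\<^bsub>?G\<^esub>" if x: "x \<in> carrier ?G" for x
  proof -
    obtain A a where Aa: "x = (A, a)" "A \<in> GSp n" "a \<in> carrier_vec (2 * n)" using x by auto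
    obtain B where B: "B \<in> carrier_mat (2 * n) (2 * n)" "A * B = 1\<^sub>m (2 * n)" "B * A = 1\<^sub>m (2 * n)"
      using GSp_inverseE[OF Aa(2)] by blast
    have "(B, - inverse (similitude n A) \<cdot>\<^sub>v (B *\<^sub>v a)) \<in> carrier ?G"
      using GSp_inverse(1)[OF n Aa(2) B] B Aa by (simp add: mat_closed[of _ n])
    then show ?thesis using G_tilde_left_inverse[OF n Aa(2,3) B(1,3)] Aa(1) by blast
  qed
qed

lemma GammaE:
  assumes n: "n \<ge> 1" and A: "A \<in> Gamma n"
  obtains B where "A \<in> GSp n" "A \<in> integral_mats (2 * n)" "B \<in> Gamma n" "B \<in> carrier_mat (2 * n) (2 * n)"
    "A * B = 1\<^sub>m (2 * n)" "B * A = 1\<^sub>m (2 * n)"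
proof -
  obtain B where B: "A \<in> GSp n" "A \<in> integral_mats (2 * n)" "B \<in> integral_mats (2 * n)"
    "A * B = 1\<^sub>m (2 * n)" "B * A = 1\<^sub>m (2 * n)"
    using A by (auto simp: Gamma_def integral_GL_def)
  have BC: "B \<in> carrier_mat (2 * n) (2 * n)" using B(3) by (simp add: integral_mats_iff)
  have "B \<in> Gamma n"
    using GSp_inverse(1)[OF n B(1) BC B(4,5)] B by (auto simp: Gamma_def integral_GL_def)
  then show thesis using that B BC by blast
qed

text \<open>The multiplier of the integral inverse is the inverse multiplier, so both are
  integral.\<close>

lemma Gamma_similitude_unit:
  assumes n: "n \<ge> 1" and A: "A \<in> Gamma n"
  shows "similitude n A \<in> padic_units"
proof -
  obtain B where B: "A \<in> GSp n" "A \<in> integral_mats (2 * n)" "B \<in> Gamma n" "B \<in> carrier_mat (2 * n) (2 * n)"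
    "A * B = 1\<^sub>m (2 * n)" "B * A = 1\<^sub>m (2 * n)" using GammaE[OF n A] by blast
  have "B \<in> GSp n" "B \<in> integral_mats (2 * n)" using B(3) by (auto simp: Gamma_def integral_GL_def)
  then show ?thesis
    using similitude_integral[OF n] similitude_nonzero[OF n B(1)] GSp_inverse(2)[OF n B(1) B(4-6)] B(1,2)
    unfolding padic_units_def by force
qed

lemma subgroup_Gamma_tilde:
  assumes n: "n \<ge> 1"
  shows "subgroup (Gamma_tilde n) (G_tilde n :: ('p :: prime_card padic mat \<times> 'p padic vec) monoid)"
proof -
  let ?G = "G_tilde n :: ('p padic mat \<times> 'p padic vec) monoid"
  interpret group ?G by (rule group_G_tilde[OF n])
  show ?thesis
  proof (rule subgroupI)
    show "Gamma_tilde n \<subseteq> carrier ?G" by (auto simp: Gamma_tilde_def Gamma_def integral_vecs_iff)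
    have "1\<^sub>m (2 * n) \<in> Gamma n"
      using GSp_one[OF n] integral_mats_one[of "2 * n"]
      by (auto simp: Gamma_def integral_GL_def intro!: bexI[of _ "1\<^sub>m (2 * n)"])
    then show "Gamma_tilde n \<noteq> {}" using integral_vecs_zero by (auto simp: Gamma_tilde_def)
    show "inv\<^bsub>?G\<^esub> x \<in> Gamma_tilde n" if x: "x \<in> Gamma_tilde n" for x
    proof -
      obtain A a where Aa: "x = (A, a)" "A \<in> Gamma n" "a \<in> integral_vecs n"
        using x by (auto simp: Gamma_tilde_def)
      obtain B where B: "A \<in> GSp n" "A \<in> integral_mats (2 * n)" "B \<in> Gamma n" "B \<in> carrier_mat (2 * n) (2 * n)"
        "A * B = 1\<^sub>m (2 * n)" "B * A = 1\<^sub>m (2 * n)" using GammaE[OF n Aa(2)] by blast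
      let ?b = "- inverse (similitude n A) \<cdot>\<^sub>v (B *\<^sub>v a)"
      have a: "a \<in> carrier_vec (2 * n)" using Aa by (simp add: integral_vecs_iff)
      have "?b \<in> integral_vecs n"
        using Gamma_similitude_unit[OF n Aa(2)] B(3) Aa(3)
        by (intro integral_vecs_smult integral_vecs_mult_mat padic_integers_uminus)
          (auto simp: padic_units_def Gamma_def integral_GL_def)
      then have "(B, ?b) \<in> Gamma_tilde n" using B by (simp add: Gamma_tilde_def)
      moreover have "(B, ?b) \<otimes>\<^bsub>?G\<^esub> x = \<one>\<^bsub>?G\<^esub>"
        unfolding Aa(1) by (rule G_tilde_left_inverse[OF n B(1) a B(4,6)])
      moreover have "x \<in> carrier ?G" "(B, ?b) \<in> carrier ?G"
        using Aa a B by (auto simp: Gamma_def mat_closed[of _ n])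
      ultimately show ?thesis using inv_equality by metis
    qed
    show "x \<otimes>\<^bsub>?G\<^esub> y \<in> Gamma_tilde n" if x: "x \<in> Gamma_tilde n" "y \<in> Gamma_tilde n" for x y
    proof -
      obtain A a where Aa: "x = (A, a)" "A \<in> Gamma n" "a \<in> integral_vecs n"
        using x by (auto simp: Gamma_tilde_def)
      obtain C c where Cc: "y = (C, c)" "C \<in> Gamma n" "c \<in> integral_vecs n"
        using x by (auto simp: Gamma_tilde_def)
      obtain B where B: "A \<in> GSp n" "A \<in> integral_mats (2 * n)" "B \<in> Gamma n" "B \<in> carrier_mat (2 * n) (2 * n)"
        "A * B = 1\<^sub>m (2 * n)" "B * A = 1\<^sub>m (2 * n)" using GammaE[OF n Aa(2)] by blast
      obtain D where D: "C \<in> GSp n" "C \<in> integral_mats (2 * n)" "D \<in> Gamma n" "D \<in> carrier_mat (2 * n) (2 * n)"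
        "C * D = 1\<^sub>m (2 * n)" "D * C = 1\<^sub>m (2 * n)" using GammaE[OF n Cc(2)] by blast
      note AC = GSp_carrier[OF B(1)] GSp_carrier[OF D(1)]
      have "(A * C) * (D * B) = A * (C * D) * B" "(D * B) * (A * C) = D * (B * A) * C"
        using AC B(4) D(4) by (simp_all add: mat_assoc[of _ n] mat_closed[of _ n])
      then have "(A * C) * (D * B) = 1\<^sub>m (2 * n)" "(D * B) * (A * C) = 1\<^sub>m (2 * n)"
        using AC B D by simp_all
      moreover have "D * B \<in> integral_mats (2 * n)"
        using B(3) D(3) by (intro integral_mats_mult) (auto simp: Gamma_def integral_GL_def)
      ultimately have "A * C \<in> Gamma n"
        using GSp_mult(1)[OF n B(1) D(1)] integral_mats_mult[OF B(2) D(2)]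
        by (auto simp: Gamma_def integral_GL_def)
      moreover have "A *\<^sub>v c + similitude n C \<cdot>\<^sub>v a \<in> integral_vecs n"
        using B(2) Aa(3) Cc(3) similitude_integral[OF n D(1,2)]
        by (intro integral_vecs_add integral_vecs_mult_mat integral_vecs_smult)
      ultimately show ?thesis using Aa Cc by (simp add: Gamma_tilde_def)
    qed
  qed
qed

section \<open>The levels\<close>

definition level :: "nat \<Rightarrow> nat \<Rightarrow> ('p :: prime_card padic mat \<times> 'p padic vec) set" where
  "level n k = {(C, c) \<in> Delta_tilde n. padic_val (similitude n C) = int k}"

lemma level_iff:
  assumes n: "n \<ge> 1"
  shows "(C, c) \<in> level n k \<longleftrightarrow> C \<in> GSp n \<and> C \<in> integral_mats (2 * n) \<and> c \<in> integral_vecs n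
    \<and> (\<exists>u \<in> padic_units. similitude n C = prime_elt ^ k * u)"
  using padic_val_eq_iff[OF similitude_integral[OF n] similitude_nonzero[OF n], of C k]
  by (auto simp: level_def Delta_tilde_def Delta_def)

lemma level_subset: "level n k \<subseteq> Delta_tilde n"
  by (auto simp: level_def)

lemma level_carrier: "level n k \<subseteq> carrier (G_tilde n)"
  by (auto simp: level_def Delta_tilde_def Delta_def integral_vecs_iff)

lemma level_mult:
  assumes n: "n \<ge> 1" and x: "x \<in> level n k" and y: "y \<in> level n l"
  shows "x \<otimes>\<^bsub>G_tilde n\<^esub> y \<in> level n (k + l)"
proof -
  obtain A a u where A: "x = (A, a)" "A \<in> GSp n" "A \<in> integral_mats (2 * n)" "a \<in> integral_vecs n"
    "u \<in> padic_units" "similitude n A = prime_elt ^ k * u"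
    using x level_iff[OF n] by (cases x) blast
  obtain B b w where B: "y = (B, b)" "B \<in> GSp n" "B \<in> integral_mats (2 * n)" "b \<in> integral_vecs n"
    "w \<in> padic_units" "similitude n B = prime_elt ^ l * w"
    using y level_iff[OF n] by (cases y) blast
  have "similitude n (A * B) = prime_elt ^ (k + l) * (u * w)"
    by (simp add: GSp_mult(2)[OF n A(2) B(2)] A(6) B(6) power_add)
  moreover have "A *\<^sub>v b + similitude n B \<cdot>\<^sub>v a \<in> integral_vecs n"
    using A B similitude_integral[OF n B(2,3)]
    by (intro integral_vecs_add integral_vecs_mult_mat integral_vecs_smult)
  ultimately show ?thesis
    using A B GSp_mult(1)[OF n A(2) B(2)] integral_mats_mult[OF A(3) B(3)] padic_units_mult[OF A(5) B(5)]
    by (auto simp: level_iff[OF n])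
qed

lemma Gamma_tilde_subset_level: "n \<ge> 1 \<Longrightarrow> Gamma_tilde n \<subseteq> level n 0"
  using Gamma_similitude_unit by (auto simp: Gamma_tilde_def level_iff) (auto simp: Gamma_def integral_GL_def)

text \<open>\<open>Gamma_tilde n\<close> lies in level 0 and levels add under
  multiplication.\<close>

lemma biinvariant_level:
  assumes n: "n \<ge> 1"
  shows "group.biinvariant (G_tilde n :: ('p :: prime_card padic mat \<times> 'p padic vec) monoid)
    (Gamma_tilde n) (level n k)"
proof -
  interpret group "G_tilde n :: ('p padic mat \<times> 'p padic vec) monoid" by (rule group_G_tilde[OF n])
  show ?thesis
    unfolding biinvariant_def
  proof (intro conjI ballI)
    fix h s :: "'p padic mat \<times> 'p padic vec"
    assume "h \<in> Gamma_tilde n" and s: "s \<in> level n k"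
    then have h: "h \<in> level n 0" using Gamma_tilde_subset_level[OF n] by blast
    show "h \<otimes>\<^bsub>G_tilde n\<^esub> s \<in> level n k" using level_mult[OF n h s] by simp
    show "s \<otimes>\<^bsub>G_tilde n\<^esub> h \<in> level n k" using level_mult[OF n s h] by simp
  qed (rule level_carrier)
qed

section \<open>Finiteness\<close>

lemma integral_mats_congruent:
  fixes A B :: "'p :: prime_card padic mat"
  assumes A: "A \<in> integral_mats m" and B: "B \<in> integral_mats m"
    and eq: "\<And>i j. i < m \<Longrightarrow> j < m \<Longrightarrow> padic_residue N (A $$ (i, j)) = padic_residue N (B $$ (i, j))"
  obtains E where "E \<in> integral_mats m" "B = A + prime_elt ^ N \<cdot>\<^sub>m E"
proof
  let ?E = "mat m m (\<lambda>(i, j). inverse (prime_elt ^ N) * (B $$ (i, j) - A $$ (i, j)))"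
  have p: "(prime_elt :: 'p padic) ^ N \<noteq> 0" using prime_elt_nonzero by (rule power_not_zero)
  have "inverse (prime_elt ^ N) * (B $$ (i, j) - A $$ (i, j)) \<in> padic_integers" if ij: "i < m" "j < m" for i j
  proof -
    obtain z where "z \<in> padic_integers" "B $$ (i, j) - A $$ (i, j) = prime_elt ^ N * z"
      using padic_residue_eqD[of "B $$ (i, j)" "A $$ (i, j)" N] eq[OF ij] ij A B
      unfolding integral_mats_iff by metis
    then show ?thesis using p by (simp flip: mult.assoc)
  qed
  then show "?E \<in> integral_mats m" by (simp add: integral_mats_iff)
  show "B = A + prime_elt ^ N \<cdot>\<^sub>m ?E"
    using A B p by (intro eq_matI) (auto simp: integral_mats_iff simp flip: mult.assoc)
qed

lemma integral_vecs_congruent: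
  fixes a b :: "'p :: prime_card padic vec"
  assumes a: "a \<in> integral_vecs n" and b: "b \<in> integral_vecs n"
    and eq: "\<And>i. i < 2 * n \<Longrightarrow> padic_residue N (a $ i) = padic_residue N (b $ i)"
  obtains e where "e \<in> integral_vecs n" "b = a + prime_elt ^ N \<cdot>\<^sub>v e"
proof
  let ?e = "vec (2 * n) (\<lambda>i. inverse (prime_elt ^ N) * (b $ i - a $ i))"
  have p: "(prime_elt :: 'p padic) ^ N \<noteq> 0" using prime_elt_nonzero by (rule power_not_zero)
  have "inverse (prime_elt ^ N) * (b $ i - a $ i) \<in> padic_integers" if i: "i < 2 * n" for i
  proof -
    obtain z where "z \<in> padic_integers" "b $ i - a $ i = prime_elt ^ N * z"
      using padic_residue_eqD[of "b $ i" "a $ i" N] eq[OF i] i a b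
      unfolding integral_vecs_iff by metis
    then show ?thesis using p by (simp flip: mult.assoc)
  qed
  then show "?e \<in> integral_vecs n" by (simp add: integral_vecs_iff)
  show "b = a + prime_elt ^ N \<cdot>\<^sub>v ?e"
    using a b p by (intro eq_vecI) (auto simp: integral_vecs_iff simp flip: mult.assoc)
qed

text \<open>
  The adjoint \<open>D\<^sup>* = \<mu>(D) D\<^sup>-\<^sup>1\<close> is integral, so \<open>D' D\<^sup>-\<^sup>1\<close> is integral as soon as
  \<open>D' - D\<close> is divisible by \<open>\<mu>(D)\<close>.
\<close>

lemma congruent_quotient:
  fixes D D' :: "'p :: prime_card padic mat"
  assumes n: "n \<ge> 1" and D: "D \<in> GSp n" "D \<in> integral_mats (2 * n)" and D': "D' \<in> GSp n"
    and u: "u \<in> padic_units" "similitude n D = prime_elt ^ m * u"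
    and E: "E \<in> integral_mats (2 * n)" "D' = D + prime_elt ^ (2 * m) \<cdot>\<^sub>m E"
  obtains Z where "Z \<in> integral_mats (2 * n)" "1\<^sub>m (2 * n) + prime_elt ^ m \<cdot>\<^sub>m Z \<in> GSp n"
    "(1\<^sub>m (2 * n) + prime_elt ^ m \<cdot>\<^sub>m Z) * D = D'"
proof
  \<comment> \<open>Chosen so that \<open>(prime_elt ^ m \<cdot>\<^sub>m ?Z) * D\<close> equals D' -
    D: multiplying the adjoint by D yields \<mu>(D) = p^m u, which supplies one of the two factors
    p^m and cancels the inverse of u.\<close>
  let ?Z = "inverse u \<cdot>\<^sub>m (E * symp_adjoint n D)"
  let ?U = "1\<^sub>m (2 * n) + prime_elt ^ m \<cdot>\<^sub>m (inverse u \<cdot>\<^sub>m (E * symp_adjoint n D))"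
  have "symp_adjoint n D \<in> integral_mats (2 * n)"
    unfolding symp_adjoint_def
    by (intro integral_mats_mult integral_mats_smult integral_mats_transpose integral_symp_J D) auto
  then show Z: "?Z \<in> integral_mats (2 * n)"
    using u(1) E(1) by (intro integral_mats_smult integral_mats_mult) (auto simp: padic_units_def)
  have C: "D \<in> carrier_mat (2 * n) (2 * n)" "E \<in> carrier_mat (2 * n) (2 * n)"
    "symp_adjoint n D \<in> carrier_mat (2 * n) (2 * n)" "?Z \<in> carrier_mat (2 * n) (2 * n)"
    using Z E(1) symp_adjoint_carrier[OF GSp_carrier[OF D(1)]] GSp_carrier[OF D(1)]
    by (auto simp: integral_mats_iff)
  have "(E * symp_adjoint n D) * D = similitude n D \<cdot>\<^sub>m E"
    using C by (simp add: mat_assoc[of _ n] symp_adjoint_mult[OF n D(1)] mat_smult[of _ n])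
  then have "(prime_elt ^ m \<cdot>\<^sub>m ?Z) * D = (prime_elt ^ m * (inverse u * similitude n D)) \<cdot>\<^sub>m E"
    using C by (simp add: mat_smult[of _ n] smult_smult_mat mat_closed[of _ n] mult.assoc)
  also have "prime_elt ^ m * (inverse u * similitude n D) = prime_elt ^ (2 * m)"
    using u by (simp add: padic_units_def mult_2 power_add)
  finally have "(prime_elt ^ m \<cdot>\<^sub>m ?Z) * D = prime_elt ^ (2 * m) \<cdot>\<^sub>m E" .
  then show eq: "?U * D = D'"
    using C E(2) by (subst add_mult_distrib_mat[of _ "2 * n" "2 * n" _ _ "2 * n"]) auto
  \<comment> \<open>That the matrix is a similitude cannot be seen from its additive form; it
    follows by rewriting it as D' times the inverse of D.\<close>
  obtain B where B: "B \<in> carrier_mat (2 * n) (2 * n)" "D * B = 1\<^sub>m (2 * n)" "B * D = 1\<^sub>m (2 * n)"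
    using GSp_inverseE[OF D(1)] by blast
  have U: "?U \<in> carrier_mat (2 * n) (2 * n)" using C by simp
  have "D' * B = ?U * (D * B)" unfolding eq[symmetric] by (rule assoc_mult_mat[OF U C(1) B(1)])
  then have "?U = D' * B" using B(2) right_mult_one_mat[OF U] by simp
  then show "?U \<in> GSp n" using GSp_mult(1)[OF n D' GSp_inverse(1)[OF n D(1) B]] by simp
qed

text \<open>The precision 2m pays for two divisions by \<mu>(D), of valuation m. The first makes U =
  D' D^(-1) integral and still congruent to 1 modulo p^m; the second solves for the vector part of
  the quotient, using that congruence.\<close>

lemma level_coset_eq:
  fixes D D' :: "'p :: prime_card padic mat"
  assumes n: "n \<ge> 1" and x: "(D, d) \<in> level n m" and y: "(D', d') \<in> level n m"
    and D_eq: "\<And>i j. i < 2 * n \<Longrightarrow> j < 2 * n \<Longrightarrow>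
      padic_residue (2 * m) (D $$ (i, j)) = padic_residue (2 * m) (D' $$ (i, j))"
    and d_eq: "\<And>i. i < 2 * n \<Longrightarrow> padic_residue (2 * m) (d $ i) = padic_residue (2 * m) (d' $ i)"
  shows "Gamma_tilde n #>\<^bsub>G_tilde n\<^esub> (D, d) = Gamma_tilde n #>\<^bsub>G_tilde n\<^esub> (D', d')"
proof -
  let ?G = "G_tilde n :: ('p padic mat \<times> 'p padic vec) monoid"
  interpret group ?G by (rule group_G_tilde[OF n])
  obtain u where D: "D \<in> GSp n" "D \<in> integral_mats (2 * n)" "d \<in> integral_vecs n"
    and u: "u \<in> padic_units" "similitude n D = prime_elt ^ m * u" using x level_iff[OF n] by blast
  obtain u' where D': "D' \<in> GSp n" "D' \<in> integral_mats (2 * n)" "d' \<in> integral_vecs n"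
    and u': "u' \<in> padic_units" "similitude n D' = prime_elt ^ m * u'" using y level_iff[OF n] by blast
  obtain E where E: "E \<in> integral_mats (2 * n)" "D' = D + prime_elt ^ (2 * m) \<cdot>\<^sub>m E"
    using integral_mats_congruent[OF D(2) D'(2) D_eq] by blast
  obtain E' where E': "E' \<in> integral_mats (2 * n)" "D = D' + prime_elt ^ (2 * m) \<cdot>\<^sub>m E'"
    using integral_mats_congruent[OF D'(2) D(2) D_eq[symmetric]] by blast
  obtain e where e: "e \<in> integral_vecs n" "d' = d + prime_elt ^ (2 * m) \<cdot>\<^sub>v e"
    using integral_vecs_congruent[OF D(3) D'(3) d_eq] by blast
  obtain Z where Z: "Z \<in> integral_mats (2 * n)" "1\<^sub>m (2 * n) + prime_elt ^ m \<cdot>\<^sub>m Z \<in> GSp n"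
    "(1\<^sub>m (2 * n) + prime_elt ^ m \<cdot>\<^sub>m Z) * D = D'"
    using congruent_quotient[OF n D(1,2) D'(1) u E] by blast
  obtain Z' where Z': "Z' \<in> integral_mats (2 * n)" "1\<^sub>m (2 * n) + prime_elt ^ m \<cdot>\<^sub>m Z' \<in> GSp n"
    "(1\<^sub>m (2 * n) + prime_elt ^ m \<cdot>\<^sub>m Z') * D' = D"
    using congruent_quotient[OF n D'(1,2) D(1) u' E'] by blast
  define U where "U = 1\<^sub>m (2 * n) + prime_elt ^ m \<cdot>\<^sub>m Z"
  define V where "V = 1\<^sub>m (2 * n) + prime_elt ^ m \<cdot>\<^sub>m Z'"
  note UV = Z(2,3)[folded U_def] Z'(2,3)[folded V_def]
  have integral: "U \<in> integral_mats (2 * n)" "V \<in> integral_mats (2 * n)"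
    unfolding U_def V_def using Z(1) Z'(1)
    by (auto intro!: integral_mats_add integral_mats_one integral_mats_smult padic_integers_power)
  \<comment> \<open>The construction with the roles of D and D' exchanged gives an integral V. As UV
    fixes the invertible D' and VU fixes D, the two are inverse to each other, so U lies in
    \<open>Gamma n\<close>.\<close>
  have cancel: "P * Q = 1\<^sub>m (2 * n)"
    if F: "F \<in> GSp n" and PQ: "P \<in> carrier_mat (2 * n) (2 * n)" "Q \<in> carrier_mat (2 * n) (2 * n)"
      "P * (Q * F) = F" for P Q F :: "'p padic mat"
  proof -
    obtain B where B: "B \<in> carrier_mat (2 * n) (2 * n)" "F * B = 1\<^sub>m (2 * n)" using GSp_inverseE[OF F] by blast
    note FC = GSp_carrier[OF F]
    have "(P * Q) * (F * B) = (P * (Q * F)) * B"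
      using PQ(1,2) FC B(1) by (simp add: mat_assoc[of _ n] mat_closed[of _ n])
    then show ?thesis using PQ B by (simp add: mat_closed[of _ n])
  qed
  have "U * V = 1\<^sub>m (2 * n)" "V * U = 1\<^sub>m (2 * n)"
    using cancel[OF D'(1), of U V] cancel[OF D(1), of V U] UV GSp_carrier by auto
  then have U: "U \<in> Gamma n" using UV integral by (auto simp: Gamma_def integral_GL_def)
  \<comment> \<open>This solves \<mu>(D) w = d' - U d, whose right side is p^m times (p^m e - Z
    d).\<close>
  define w where "w = inverse u \<cdot>\<^sub>v (prime_elt ^ m \<cdot>\<^sub>v e - Z *\<^sub>v d)"
  have "prime_elt ^ m \<in> (padic_integers :: 'p padic set)" by (rule padic_integers_power) simp
  then have w: "w \<in> integral_vecs n"
    unfolding w_def using u(1) e(1) Z(1) D(3)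
    by (intro integral_vecs_smult integral_vecs_diff integral_vecs_mult_mat) (auto simp: padic_units_def)
  have C: "d \<in> carrier_vec (2 * n)" "e \<in> carrier_vec (2 * n)" "Z \<in> carrier_mat (2 * n) (2 * n)"
    using D(3) e(1) Z(1) by (auto simp: integral_vecs_iff integral_mats_iff)
  have Zd: "Z *\<^sub>v d \<in> carrier_vec (2 * n)" using C by (simp add: mat_closed[of _ n])
  have "U *\<^sub>v d = d + prime_elt ^ m \<cdot>\<^sub>v (Z *\<^sub>v d)"
    unfolding U_def using C
    by (subst add_mult_distrib_mat_vec[of _ "2 * n" "2 * n"]) (simp_all add: smult_mat_mult_vec)
  moreover have "similitude n D \<cdot>\<^sub>v w = prime_elt ^ m \<cdot>\<^sub>v (prime_elt ^ m \<cdot>\<^sub>v e - Z *\<^sub>v d)"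
    using u by (simp add: w_def smult_smult_assoc padic_units_def mult.assoc)
  moreover have "(prime_elt :: 'p padic) ^ (2 * m) = prime_elt ^ m * prime_elt ^ m"
    by (simp add: mult_2 power_add)
  then have "d' = d + prime_elt ^ m \<cdot>\<^sub>v (Z *\<^sub>v d) + prime_elt ^ m \<cdot>\<^sub>v (prime_elt ^ m \<cdot>\<^sub>v e - Z *\<^sub>v d)"
    unfolding e(2) using carrier_vecD[OF C(1)] carrier_vecD[OF C(2)] carrier_vecD[OF Zd]
    by (intro eq_vecI) (auto simp: right_diff_distrib mult.assoc simp del: dim_mult_mat_vec index_mult_mat_vec)
  ultimately have "(U, w) \<otimes>\<^bsub>?G\<^esub> (D, d) = (D', d')" using UV(2) by simp
  moreover have "(U, w) \<in> Gamma_tilde n" using U w by (simp add: Gamma_tilde_def)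
  ultimately have "(D', d') \<in> Gamma_tilde n #>\<^bsub>?G\<^esub> (D, d)" unfolding r_coset_def by force
  then show ?thesis
    using repr_independence[OF _ _ subgroup_Gamma_tilde[OF n]] x level_carrier by blast
qed

lemma finite_image_if_determined:
  assumes "finite (f ` S)" "\<And>x y. x \<in> S \<Longrightarrow> y \<in> S \<Longrightarrow> f x = f y \<Longrightarrow> g x = g y"
  shows "finite (g ` S)"
proof -
  have "g x = g (inv_into S f (f x))" if "x \<in> S" for x
    using that by (intro assms(2)) (auto simp: inv_into_into f_inv_into_f)
  then have "g ` S \<subseteq> (\<lambda>z. g (inv_into S f z)) ` f ` S" by blast
  then show ?thesis using assms(1) finite_subset by blast
qed

lemma finite_level_cosets:
  assumes n: "n \<ge> 1"
  shows "finite ((\<lambda>x. Gamma_tilde n #>\<^bsub>G_tilde n\<^esub> x) `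
    (level n m :: ('p :: prime_card padic mat \<times> 'p padic vec) set))"
proof (rule finite_image_if_determined)
  define I where "I = {..<2 * n}"
  define r where "r = (padic_residue (2 * m) :: 'p padic \<Rightarrow> int)"
  \<comment> \<open>The table of all residues of the entries. Restricting to the index ranges makes
    the tables extensional functions, of which there are only finitely many.\<close>
  define f where "f x = (restrict (\<lambda>ij. r (fst x $$ ij)) (I \<times> I), restrict (\<lambda>i. r (snd x $ i)) I)"
    for x :: "'p padic mat \<times> 'p padic vec"
  let ?R = "{0..<int CARD('p) ^ (2 * m)}"
  have "f ` level n m \<subseteq> ((I \<times> I) \<rightarrow>\<^sub>E ?R) \<times> (I \<rightarrow>\<^sub>E ?R)"
    using padic_residue_range[where 'p = 'p]
    by (intro image_subsetI) (simp add: f_def r_def mem_Times_iff restrict_PiE_iff del: atLeastLessThan_iff)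
  then show "finite (f ` level n m)"
    by (rule finite_subset) (auto simp: I_def intro!: finite_PiE)
  fix x y :: "'p padic mat \<times> 'p padic vec"
  assume xy: "x \<in> level n m" "y \<in> level n m" and eq: "f x = f y"
  have "r (fst x $$ (i, j)) = r (fst y $$ (i, j))" if "i < 2 * n" "j < 2 * n" for i j
    using fun_cong[OF arg_cong[OF eq, of fst], of "(i, j)"] that by (simp add: f_def I_def)
  moreover have "r (snd x $ i) = r (snd y $ i)" if "i < 2 * n" for i
    using fun_cong[OF arg_cong[OF eq, of snd], of i] that by (simp add: f_def I_def)
  ultimately show "Gamma_tilde n #>\<^bsub>G_tilde n\<^esub> x = Gamma_tilde n #>\<^bsub>G_tilde n\<^esub> y"
    using level_coset_eq[OF n, of "fst x" "snd x" m "fst y" "snd y"] xy by (simp add: r_def)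
qed

lemma T_tilde_mult_nonzero_iff:
  fixes g :: "'p :: prime_card padic mat \<times> 'p padic vec"
  assumes n: "n \<ge> 1" and g: "g \<in> Delta_tilde n"
  shows "Poly_Mapping.lookup (T_tilde TYPE('p) n k \<otimes>\<^bsub>R_tilde TYPE('p) n\<^esub> T_tilde TYPE('p) n l)
      (double_coset (G_tilde n) (Gamma_tilde n) g) \<noteq> 0
    \<longleftrightarrow> g \<in> level n k <#>\<^bsub>G_tilde n\<^esub> level n l"
proof -
  let ?G = "G_tilde n :: ('p padic mat \<times> 'p padic vec) monoid"
  let ?H = "Gamma_tilde n :: ('p padic mat \<times> 'p padic vec) set"
  interpret group ?G by (rule group_G_tilde[OF n])
  have T: "T_tilde TYPE('p) n j = (\<Sum>X \<in> double_coset ?G ?H ` level n j. frag_of X)" for j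
    unfolding T_tilde_def level_def by (rule sum.cong) auto
  \<comment> \<open>A product of two levels lies in a single level, so it inherits the finiteness of
    cosets proved there.\<close>
  have "level n k <#>\<^bsub>?G\<^esub> level n l \<subseteq> level n (k + l)"
    using level_mult[OF n] by (auto simp only: set_mult_def)
  then have "finite ((\<lambda>x. ?H #>\<^bsub>?G\<^esub> x) ` (level n k <#>\<^bsub>?G\<^esub> level n l))"
    using finite_level_cosets[OF n] by (meson finite_subset image_mono)
  moreover have "Delta_tilde n \<subseteq> carrier ?G"
    by (auto simp: Delta_tilde_def Delta_def integral_vecs_iff)
  ultimately show ?thesis
    unfolding R_tilde_def T
    using lookup_hecke_mult_nonzero_iff[OF subgroup_Gamma_tilde[OF n] biinvariant_level[OF n]
        biinvariant_level[OF n] finite_level_cosets[OF n] finite_level_cosets[OF n]] g by blast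
qed

section \<open>The witness\<close>

text \<open>For 2 by 2 matrices the multiplier of the form is the determinant, and the inverse is
  given by Cramer's rule.\<close>

lemma GSp_scalar_blocks:
  fixes a b c d :: "'a :: field"
  assumes n: "n \<ge> 1" and det: "a * d - b * c \<noteq> 0"
  shows "scalar_blocks n a b c d \<in> GSp n" "similitude n (scalar_blocks n a b c d) = a * d - b * c"
proof -
  let ?g = "scalar_blocks n a b c d" and ?\<delta> = "a * d - b * c"
  let ?h = "inverse ?\<delta> \<cdot>\<^sub>m scalar_blocks n d (- b) (- c) a"
  have form: "transpose_mat ?g * symp_J n * ?g = ?\<delta> \<cdot>\<^sub>m symp_J n"
    by (simp add: symp_J_scalar_blocks transpose_scalar_blocks scalar_blocks_mult smult_scalar_blocks algebra_simps)
  then show "similitude n ?g = ?\<delta>" by (rule similitude_eqI[OF n])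
  have inv: "inverse ?\<delta> * (a * d) - inverse ?\<delta> * (b * c) = 1"
    using det by (simp add: right_diff_distrib[symmetric])
  have "?g * ?h = 1\<^sub>m (2 * n)" "?h * ?g = 1\<^sub>m (2 * n)"
    unfolding smult_scalar_blocks scalar_blocks_mult one_scalar_blocks
    using inv by (simp_all add: mult_ac)
  moreover have "dim_row ?g = 2 * n" "dim_row ?h = 2 * n" "dim_col ?g = 2 * n" "dim_col ?h = 2 * n"
    using scalar_blocks_carrier by (auto simp: carrier_matD[OF scalar_blocks_carrier])
  ultimately have "invertible_mat ?g"
    by (auto simp: invertible_mat_def inverts_mat_def intro!: exI[of _ ?h])
  then show "?g \<in> GSp n" using form by (auto simp: GSp_def)
qed

lemma scalar_blocks_mult_unit_vec:
  assumes "n \<ge> 1"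
  shows "scalar_blocks n a b c d *\<^sub>v unit_vec (2 * n) 0 = vec (2 * n) (\<lambda>i. if i = 0 then a else if i = n then c else 0)"
  using assms by (intro eq_vecI) (auto simp: carrier_matD[OF scalar_blocks_carrier] index_scalar_blocks)

lemma integral_unit_vec: "unit_vec (2 * n) i \<in> integral_vecs n"
  by (simp add: integral_vecs_iff unit_vec_def)

text \<open>
  Writing \<open>e\<close> for the first unit vector and \<open>f = e\<^sub>n\<^sub>+\<^sub>1\<close>, the witness is
  \<open>g = (A, 0) (D, e) = (AD, e)\<close>, where \<open>A e = e\<close> and \<open>AD e = p e + p\<^sup>k f\<close>.
  The pairing of \<open>e\<close> with \<open>AD e\<close> has valuation \<open>k\<close>.
  In a factorization \<open>g = (A', a') (D', d')\<close> with the levels interchanged, both summands of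
  \<open>e = A' d' + \<mu>(D') a'\<close> pair with \<open>AD e = A' (D' e)\<close> to a multiple of \<open>p\<^sup>k\<^sup>+\<^sup>1\<close>.
\<close>

lemma level_products_not_commuting:
  assumes n: "n \<ge> 1" and k: "0 < k" "k < l"
  obtains g :: "'p :: prime_card padic mat \<times> 'p padic vec" where
    "g \<in> Delta_tilde n" "g \<in> level n k <#>\<^bsub>G_tilde n\<^esub> level n l"
    "g \<notin> level n l <#>\<^bsub>G_tilde n\<^esub> level n k"
proof
  let ?p = "prime_elt :: 'p padic"
  define e :: "'p padic vec" where "e = unit_vec (2 * n) 0"
  \<comment> \<open>A fixes e, so the vector part of g is e. D sends e to p e + f: the summand f
    pairs with e to 1, and the coefficient p together with the p^k from A makes AD e divisible by
    p.\<close>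
  define A where "A = scalar_blocks n 1 0 0 (?p ^ k)"
  define D where "D = scalar_blocks n ?p 0 1 (?p ^ (l - 1))"
  define C where "C = A * D"
  let ?g = "(A, 0\<^sub>v (2 * n)) \<otimes>\<^bsub>G_tilde n\<^esub> (D, e)"
  have p: "?p \<noteq> 0" by (rule prime_elt_nonzero)
  have pl: "?p * ?p ^ (l - 1) = ?p ^ l" using k by (simp flip: power_Suc)
  have p_int: "?p ^ j \<in> padic_integers" for j by (simp add: padic_integers_power)
  have e: "e \<in> integral_vecs n" "e \<in> carrier_vec (2 * n)" using integral_unit_vec by (auto simp: e_def)
  have A: "A \<in> GSp n" "similitude n A = ?p ^ k" "A \<in> integral_mats (2 * n)"
    unfolding A_def using GSp_scalar_blocks[OF n, of 1 "?p ^ k" 0 0] p p_int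
    by (auto intro!: integral_scalar_blocks)
  have D: "D \<in> GSp n" "similitude n D = ?p ^ l" "D \<in> integral_mats (2 * n)"
    unfolding D_def using GSp_scalar_blocks[OF n, of ?p "?p ^ (l - 1)" 0 1] p p_int pl
    by (auto intro!: integral_scalar_blocks)
  have "(A, 0\<^sub>v (2 * n)) \<in> level n k" "(D, e) \<in> level n l"
    using A D e integral_vecs_zero by (auto simp: level_iff[OF n] intro!: bexI[of _ 1])
  then show "?g \<in> level n k <#>\<^bsub>G_tilde n\<^esub> level n l" "?g \<in> Delta_tilde n"
    using level_mult[OF n] level_subset unfolding set_mult_def by blast+
  have Ae: "A *\<^sub>v e = e"
    unfolding A_def e_def scalar_blocks_mult_unit_vec[OF n] by (intro eq_vecI) auto
  have "e + similitude n D \<cdot>\<^sub>v 0\<^sub>v (2 * n) = e" using e(2) by (intro eq_vecI) auto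
  then have g: "?g = (C, e)" using Ae by (simp add: C_def)
  \<comment> \<open>The quotient of C e by p, namely e + p^(k-1) f; it is integral because k >
    0.\<close>
  define y where "y = scalar_blocks n 1 0 (?p ^ (k - 1)) 0 *\<^sub>v e"
  have y: "y \<in> integral_vecs n" unfolding y_def
    using e p_int by (intro integral_vecs_mult_mat integral_scalar_blocks) auto
  have Ce: "C *\<^sub>v e = ?p \<cdot>\<^sub>v y"
    using k unfolding C_def A_def D_def y_def e_def scalar_blocks_mult scalar_blocks_mult_unit_vec[OF n]
    by (intro eq_vecI) (auto simp flip: power_Suc)
  have e_form: "symp_form n e (C *\<^sub>v e) = ?p ^ k"
  proof -
    have "symp_form n e (C *\<^sub>v e) = symp_form n (A *\<^sub>v e) (A *\<^sub>v (D *\<^sub>v e))"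
      using GSp_carrier[OF A(1)] GSp_carrier[OF D(1)] e by (simp add: Ae C_def mat_vec_assoc[of _ n])
    also have "\<dots> = ?p ^ k * symp_form n e (D *\<^sub>v e)"
      using symp_form_GSp[OF n A(1) e(2)] A(2) e GSp_carrier[OF D(1)] by (simp add: mat_closed[of _ n])
    also have "symp_form n e (D *\<^sub>v e) = e \<bullet> ((symp_J n * D) *\<^sub>v e)"
      unfolding symp_form_def using GSp_carrier[OF D(1)] e by (simp add: mat_vec_assoc[of _ n])
    also have "\<dots> = 1"
      unfolding symp_J_scalar_blocks D_def scalar_blocks_mult e_def scalar_blocks_mult_unit_vec[OF n]
      using n by simp
    finally show ?thesis by simp
  qed
  show "?g \<notin> level n l <#>\<^bsub>G_tilde n\<^esub> level n k"
  proof
    assume "?g \<in> level n l <#>\<^bsub>G_tilde n\<^esub> level n k"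
    then obtain A' a' D' d' where A'_level: "(A', a') \<in> level n l" and D'_level: "(D', d') \<in> level n k"
      and "?g = (A', a') \<otimes>\<^bsub>G_tilde n\<^esub> (D', d')"
      unfolding set_mult_def by auto
    then have C': "C = A' * D'" and e': "e = A' *\<^sub>v d' + similitude n D' \<cdot>\<^sub>v a'" unfolding g by simp_all
    obtain u where A': "A' \<in> GSp n" "A' \<in> integral_mats (2 * n)" "a' \<in> integral_vecs n"
      and u: "u \<in> padic_integers" "similitude n A' = ?p ^ l * u"
      using A'_level by (auto simp: level_iff[OF n] padic_units_def)
    obtain w where D': "D' \<in> GSp n" "D' \<in> integral_mats (2 * n)" "d' \<in> integral_vecs n"
      and w: "w \<in> padic_integers" "similitude n D' = ?p ^ k * w"
      using D'_level by (auto simp: level_iff[OF n] padic_units_def)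
    note A'C = GSp_carrier[OF A'(1)] and D'C = GSp_carrier[OF D'(1)]
    have C: "a' \<in> carrier_vec (2 * n)" "d' \<in> carrier_vec (2 * n)" "D' *\<^sub>v e \<in> carrier_vec (2 * n)"
      "y \<in> carrier_vec (2 * n)" "A' *\<^sub>v d' \<in> carrier_vec (2 * n)"
      using A' D' D'C A'C e y by (auto simp: integral_vecs_iff mat_closed[of _ n])
    define s where "s = symp_form n d' (D' *\<^sub>v e)"
    define t where "t = symp_form n a' y"
    have st: "s \<in> padic_integers" "t \<in> padic_integers"
      unfolding s_def t_def using A' D' e y by (auto intro!: symp_form_integral integral_vecs_mult_mat)
    have JC: "symp_J n *\<^sub>v (C *\<^sub>v e) \<in> carrier_vec (2 * n)" "symp_J n *\<^sub>v y \<in> carrier_vec (2 * n)"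
      using C(4) unfolding Ce by (simp_all add: mat_closed[of _ n])
    \<comment> \<open>The pairing of e with C e is expanded along the assumed factorization. The
      first summand uses C e = A' (D' e) and invariance under A', the second uses C e = p y.\<close>
    have "?p ^ k = symp_form n (A' *\<^sub>v d' + similitude n D' \<cdot>\<^sub>v a') (C *\<^sub>v e)"
      using e_form e' by simp
    also have "\<dots> = symp_form n (A' *\<^sub>v d') (C *\<^sub>v e) + similitude n D' * symp_form n a' (C *\<^sub>v e)"
      unfolding symp_form_def using C(1,5) JC(1)
      by (simp add: add_scalar_prod_distrib[of _ "2 * n"] smult_scalar_prod_distrib[of _ "2 * n"])
    also have "symp_form n (A' *\<^sub>v d') (C *\<^sub>v e) = symp_form n (A' *\<^sub>v d') (A' *\<^sub>v (D' *\<^sub>v e))"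
      using A'C D'C e by (simp add: C' mat_vec_assoc[of _ n])
    also have "\<dots> = ?p ^ l * u * s"
      using symp_form_GSp[OF n A'(1) C(2,3)] u(2) by (simp add: s_def)
    also have "symp_form n a' (C *\<^sub>v e) = ?p * t"
      unfolding Ce t_def symp_form_def using C(1,4) JC(2)
      by (simp add: mult_mat_vec[OF symp_J_carrier] scalar_prod_smult_distrib[of _ "2 * n"])
    finally have "?p ^ k = ?p ^ l * u * s + similitude n D' * (?p * t)" .
    \<comment> \<open>Since k < l the exponent l - k - 1 is a genuine difference, and p^(k+1) comes
      out of both summands. Cancelling p^k leaves 1 as a multiple of p.\<close>
    moreover have "?p ^ l = ?p ^ k * (?p * ?p ^ (l - k - 1))"
      using k by (simp flip: power_Suc power_add)
    ultimately have "?p ^ k * 1 = ?p ^ k * (?p * (?p ^ (l - k - 1) * u * s + w * t))"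
      unfolding w(2) by (simp add: algebra_simps)
    then have "1 = ?p * (?p ^ (l - k - 1) * u * s + w * t)" using p by (subst (asm) mult_cancel_left) simp
    then have "inverse ?p = ?p ^ (l - k - 1) * u * s + w * t" using p by (simp add: inverse_unique)
    also have "\<dots> \<in> padic_integers" using st u(1) w(1) p_int by (intro padic_integers_add padic_integers_mult)
    finally show False using inverse_prime_elt_notin by blast
  qed
qed

theorem theorem4p6:
  fixes n k l :: nat
  assumes "n \<ge> 1" and "0 < k" and "k < l"
  shows "T_tilde TYPE('p :: prime_card) n k \<otimes>\<^bsub>R_tilde TYPE('p) n\<^esub> T_tilde TYPE('p) n l
       \<noteq> T_tilde TYPE('p) n l \<otimes>\<^bsub>R_tilde TYPE('p) n\<^esub> T_tilde TYPE('p) n k"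
proof -
  obtain g :: "'p padic mat \<times> 'p padic vec" where g: "g \<in> Delta_tilde n"
    "g \<in> level n k <#>\<^bsub>G_tilde n\<^esub> level n l" "g \<notin> level n l <#>\<^bsub>G_tilde n\<^esub> level n k"
    using level_products_not_commuting[OF assms] by blast
  then show ?thesis
    using T_tilde_mult_nonzero_iff[OF assms(1) g(1), of k l]
      T_tilde_mult_nonzero_iff[OF assms(1) g(1), of l k] by metis
qed

end
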